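(* There exist an ergodic measure-preserving system $(X,\mu,T)$ and measurable sets $A,B\subseteq X$ with $\mu(A)>0$ and $\mu(B)>0$ such that, with $f_1=\mathbf 1_A$, $f_2=\mathbf 1_B$, and $\mathcal Z_\infty$ the $\infty$-step pro-nilfactor of $(X,\mu,T)$, the sets $$\alpha=\left\{n\in\mathbb Z:\int_X f_1\cdot T^nf_2\,d\mu>0\right\}$$ and $$\beta=\left\{n\in\mathbb Z:\int_X\mathbb E(f_1\mid\mathcal Z_\infty)\cdot T^n\mathbb E(f_2\mid\mathcal Z_\infty)\,d\mu>0\right\}$$ satisfy that the difference set $\beta\setminus\alpha$ has positive upper density, i.e. $\overline d(\beta\setminus\alpha)>0$. In particular, $\beta\setminus\alpha$ has positive upper Banach density, i.e. $d^*(\beta\setminus\alpha)>0$.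
   Context: A measure-preserving system $(X,\mu,T)$ consists of a standard probability space $(X,\mathcal X,\mu)$ and an invertible measure-preserving transformation $T:X\to X$. It is ergodic if every $T$-invariant measurable set has measure $0$ or $1$. For a function $f$ on $X$ and $n\in\mathbb Z$, $T^nf:=f\circ T^n$. $\mathbb E(f\mid\mathcal B)$ denotes conditional expectation on a sub-$\sigma$-algebra $\mathcal B$. Pro-nilfactors. For an ergodic system and $f\in L^\infty(\mu)$ the Host--Kra seminorms are defined by $\|f\|_{U^1}=|\int_X f\,d\mu|$ and $\|f\|_{U^{k+1}}^{2^{k+1}}=\lim_{N\to\infty}\frac1N\sum_{n=1}^{N}\|\overline f\cdot T^nf\|_{U^k}^{2^k}$. For $k\ge0$ the $k$-step pro-nilfactor $\mathcal Z_k$ is the $T$-invariant sub-$\sigma$-algebra of $\mathcal X$ characterized (modulo null sets) by: for every $f\in L^\infty(\mu)$, $\mathbb E(f\mid\mathcal Z_k)=0$ if and only if $\|f\|_{U^{k+1}}=0$. The $\infty$-step pro-nilfactor is $\mathcal Z_\infty:=\bigvee_{k\ge1}\mathcal Z_k$, the $\sigma$-algebra generated by all the $\mathcal Z_k$. Densities. For $E\subseteq\mathbb Z$, the upper density is $\overline d(E)=\limsup_{N\to\infty}\frac{|E\cap[-N,N]|}{2N+1}$ and the upper Banach density is $d^*(E)=\limsup_{N-M\to\infty}\frac{|E\cap[M,N-1]|}{N-M}$. *)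

theory Defs
  imports "HOL-Probability.Probability"
begin

definition standard_probability_space :: "'a measure \<Rightarrow> bool" where
  "standard_probability_space M \<longleftrightarrow>
     prob_space M \<and>
     (\<exists>\<tau>. topspace \<tau> = space M \<and> completely_metrizable_space \<tau> \<and> separable_space \<tau> \<and>
          sets M = sigma_sets (space M) {U. openin \<tau> U})"

definition invertible_measure_preserving :: "'a measure \<Rightarrow> ('a \<Rightarrow> 'a) \<Rightarrow> bool" where
  "invertible_measure_preserving M T \<longleftrightarrow>
     bij_betw T (space M) (space M) \<and> T \<in> M \<rightarrow>\<^sub>M M \<and>
     the_inv_into (space M) T \<in> M \<rightarrow>\<^sub>M M \<and> distr M M T = M"

definition measure_preserving_system :: "'a measure \<Rightarrow> ('a \<Rightarrow> 'a) \<Rightarrow> bool" where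
  "measure_preserving_system M T \<longleftrightarrow>
     standard_probability_space M \<and> invertible_measure_preserving M T"

definition ergodic_system :: "'a measure \<Rightarrow> ('a \<Rightarrow> 'a) \<Rightarrow> bool" where
  "ergodic_system M T \<longleftrightarrow>
     measure_preserving_system M T \<and>
     (\<forall>A\<in>sets M. T -` A \<inter> space M = A \<longrightarrow> measure M A = 0 \<or> measure M A = 1)"

text \<open>HOL cannot quantify existentially over types, so a system whose existence is claimed needs a
  fixed ambient type. With the following one nothing is lost: every Polish space is homeomorphic to
  a closed subspace of a countably infinite product of real lines, and the space of a measure need
  not be all of its type.\<close>

type_synonym point = "real \<times> (int \<Rightarrow> real)"

definition transf_power :: "'a measure \<Rightarrow> ('a \<Rightarrow> 'a) \<Rightarrow> int \<Rightarrow> 'a \<Rightarrow> 'a" where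
  "transf_power M T n =
     (if n \<ge> 0 then T ^^ nat n else the_inv_into (space M) T ^^ nat (- n))"

definition koopman :: "'a measure \<Rightarrow> ('a \<Rightarrow> 'a) \<Rightarrow> int \<Rightarrow> ('a \<Rightarrow> 'b) \<Rightarrow> 'a \<Rightarrow> 'b" where
  "koopman M T n f = f \<circ> transf_power M T n"

definition L_infinity :: "'a measure \<Rightarrow> ('a \<Rightarrow> complex) set" where
  "L_infinity M = {f \<in> borel_measurable M. \<exists>C. AE x in M. cmod (f x) \<le> C}"

definition complex_cond_exp :: "'a measure \<Rightarrow> 'a measure \<Rightarrow> ('a \<Rightarrow> complex) \<Rightarrow> 'a \<Rightarrow> complex" where
  "complex_cond_exp M F f x =
     Complex (real_cond_exp M F (\<lambda>y. Re (f y)) x) (real_cond_exp M F (\<lambda>y. Im (f y)) x)"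

text \<open>The value in degree \<open>0\<close> is a dummy; the seminorms start at degree \<open>1\<close>. For bounded functions
  on ergodic systems the limits exist, so that \<^const>\<open>lim\<close> is meaningful there.\<close>

fun host_kra_seminorm :: "'a measure \<Rightarrow> ('a \<Rightarrow> 'a) \<Rightarrow> nat \<Rightarrow> ('a \<Rightarrow> complex) \<Rightarrow> real" where
  "host_kra_seminorm M T 0 f = 0"
| "host_kra_seminorm M T (Suc 0) f = cmod (\<integral>x. f x \<partial>M)"
| "host_kra_seminorm M T (Suc (Suc k)) f =
     root (2 ^ Suc (Suc k))
       (lim (\<lambda>N. (1 / real N) *
          (\<Sum>n=1..N. host_kra_seminorm M T (Suc k)
                       (\<lambda>x. cnj (f x) * koopman M T (int n) f x) ^ (2 ^ Suc k))))"

text \<open>The defining property determines a pro-nilfactor only modulo null sets, so it is rendered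
  as a predicate on sub-\<open>\<sigma>\<close>-algebras. These are represented as measures, of which only the underlying
  measurable space matters.\<close>

definition is_pronilfactor :: "'a measure \<Rightarrow> ('a \<Rightarrow> 'a) \<Rightarrow> nat \<Rightarrow> 'a measure \<Rightarrow> bool" where
  "is_pronilfactor M T k Z \<longleftrightarrow>
     subalgebra M Z \<and>
     (\<lambda>A. T -` A \<inter> space M) ` sets Z = sets Z \<and>
     (\<forall>f\<in>L_infinity M.
        (AE x in M. complex_cond_exp M Z f x = 0) \<longleftrightarrow> host_kra_seminorm M T (k + 1) f = 0)"

definition is_infinite_step_pronilfactor :: "'a measure \<Rightarrow> ('a \<Rightarrow> 'a) \<Rightarrow> 'a measure \<Rightarrow> bool" where
  "is_infinite_step_pronilfactor M T Z \<longleftrightarrow>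
     (\<exists>Zs. (\<forall>k\<ge>1. is_pronilfactor M T k (Zs k)) \<and>
           Z = sigma (space M) (\<Union>k\<in>{1..}. sets (Zs k)))"

definition upper_density :: "int set \<Rightarrow> ereal" where
  "upper_density E =
     limsup (\<lambda>N. ereal (real (card (E \<inter> {- int N..int N})) / (2 * real N + 1)))"

text \<open>The filter describes \<open>N - M \<rightarrow> \<infinity>\<close>, with no other restriction on the endpoints.\<close>

definition upper_Banach_density :: "int set \<Rightarrow> ereal" where
  "upper_Banach_density E =
     Limsup (filtercomap (\<lambda>(M, N). N - M) at_top)
       (\<lambda>(M::int, N::int). ereal (real (card (E \<inter> {M..N - 1})) / real_of_int (N - M)))"

end

theory Submission
  imports Defs "HOL-Number_Theory.Cong" "HOL-Computational_Algebra.Primes"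
begin

text \<open>
The projections to \<open>\<Z>\<^sub>\<infinity>\<close> forget everything random in the two sets, so \<open>\<beta>\<close> only sees whether the
compact shadows of the sets overlap, whereas \<open>\<alpha>\<close> is also sensitive to the random part. On most of
\<open>\<beta> - \<alpha>\<close> the correlation of the projections has to be small, so the shadows must meet in ever
smaller overlaps.

The system is \<open>K \<times> {0,1}\<^sup>\<int>\<close>, where \<open>K\<close> is a product of cyclic groups of pairwise coprime orders
\<open>q\<^sub>0, r\<^sub>0, q\<^sub>1, r\<^sub>1, \<dots>\<close>, rotated by one in every coordinate, and the second factor is the Bernoulli
shift. The orders are primes \<open>e 1 < e 2 < \<dots>\<close> that grow very fast, with \<open>q\<^sub>j = e (2j+1)\<close>,
\<open>r\<^sub>j = e (2j+2)\<close>; put \<open>N\<^sub>j = e (2j)\<close>, so that \<open>N\<^sub>j\<close> is tiny compared with \<open>q\<^sub>j\<close> and \<open>r\<^sub>j \<le> N\<^sub>k\<close> for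
\<open>j < k\<close>. Both sets are unions over \<open>j\<close> of a cylinder in \<open>K\<close> times a cylinder in the shift. The
\<open>j\<close>-th piece of \<open>A\<close> consists of points whose coordinate at \<open>q\<^sub>j\<close> reaches zero within \<open>N\<^sub>j\<close> steps and
whose coordinates at \<open>r\<^sub>0, \<dots>, r\<^sub>j\<close> vanish; its bits in \<open>[-N\<^sub>j, N\<^sub>j]\<close> are all \<open>0\<close>. The \<open>j\<close>-th piece
of \<open>B\<close> consists of points whose coordinate at \<open>r\<^sub>j\<close> is at most \<open>N\<^sub>j\<close> and whose coordinates at
\<open>q\<^sub>0, \<dots>, q\<^sub>j\<close> vanish; its bits in \<open>[-N\<^sub>j, N\<^sub>j]\<close> are all \<open>1\<close>.

For \<open>0 \<le> n \<le> N\<^sub>k\<close> the compact parts of the \<open>k\<close>-th pieces meet at time \<open>n\<close>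
(\<open>exists_recurrent_cylinder\<close>), so \<open>n \<in> \<beta>\<close>. If \<open>n \<in> \<alpha>\<close>, the bits show that the two pieces that meet
have indices \<open>i, j\<close> with \<open>N\<^sub>i, N\<^sub>j < n\<close>; and then the piece with the smaller index \<open>l\<close> forces \<open>n\<close> to
have a residue at most \<open>N\<^sub>l\<close> modulo \<open>q\<^sub>l\<close> or \<open>r\<^sub>l\<close> (\<open>return_imp_small_residue\<close>). The last condition
holds with small density, and the densities are summable over \<open>l\<close> (\<open>card_returns_le\<close>). So at least
half of the numbers below \<open>N\<^sub>k\<close> are in \<open>\<beta> - \<alpha>\<close>, for every \<open>k\<close>.

It remains to see that the \<open>\<sigma>\<close>-algebra \<open>Z\<close> of the compact factor is a pro-nilfactor of every step
\<open>k \<ge> 1\<close>, hence equal to \<open>\<Z>\<^sub>\<infinity>\<close> (\<open>is_pronilfactor_Z\<close>). Let \<open>proj f\<close> be the integral of \<open>f\<close> over the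
shift coordinates, a version of the conditional expectation. For a function \<open>f\<close> of finitely many
coordinates and all large \<open>n\<close>, the shift coordinates of \<open>f\<close> and of \<open>T\<^sup>n f\<close> are disjoint, so
\<open>proj\<close> is multiplicative on \<open>cnj f \<cdot> T\<^sup>n f\<close>; moreover \<open>T\<^sup>n (proj f)\<close> is periodic in \<open>n\<close>. By induction
on the step, the limits that define the seminorms exist for such \<open>f\<close> and agree for \<open>f\<close> and \<open>proj f\<close>.
All this extends to bounded functions, since the powers of the seminorms are Lipschitz in \<open>L\<^sup>1\<close>
on uniformly bounded functions (\<open>hk_regular\<close>, \<open>hk_proj\<close>). Therefore \<open>proj f = 0\<close> implies
that all the seminorms vanish. Conversely, a vanishing seminorm of order at least \<open>2\<close> implies that
the one of order \<open>2\<close> vanishes (\<open>hk_mono\<close>). The latter is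
invariant under multiplication by eigenfunctions of modulus \<open>1\<close> and dominates the integral, so \<open>f\<close>
is orthogonal to all eigenfunctions. These span the functions of finitely many coordinates of \<open>K\<close>,
whence \<open>proj f = 0\<close> (\<open>hk_1_zero_imp_proj_zero\<close>).
\<close>

section \<open>Rotation of the residues modulo an integer\<close>

text \<open>A bijection of the whole real line that adds one to the residue modulo \<open>m\<close> of the integer part and
keeps the fractional part. The transformation below acts in this way on real coordinates, so that it is a
bijection of the full product space and not only of the support of the measure.\<close>

definition rotate_residue :: "nat \<Rightarrow> real \<Rightarrow> real" where
  "rotate_residue m v = (if (\<lfloor>v\<rfloor> + 1) mod int m = 0 then v + 1 - real m else v + 1)"

definition unrotate_residue :: "nat \<Rightarrow> real \<Rightarrow> real" where
  "unrotate_residue m v = (if \<lfloor>v\<rfloor> mod int m = 0 then v - 1 + real m else v - 1)"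

lemma unrotate_rotate: "unrotate_residue m (rotate_residue m v) = v"
proof -
  have "\<lfloor>v + 1 - real m\<rfloor> = \<lfloor>v\<rfloor> + 1 - int m" by linarith
  moreover have "\<lfloor>v + 1\<rfloor> = \<lfloor>v\<rfloor> + 1" by linarith
  ultimately show ?thesis
    by (auto simp: rotate_residue_def unrotate_residue_def)
qed

lemma rotate_unrotate: "rotate_residue m (unrotate_residue m v) = v"
proof -
  have "\<lfloor>v - 1 + real m\<rfloor> = \<lfloor>v\<rfloor> - 1 + int m" by linarith
  moreover have "\<lfloor>v - 1\<rfloor> = \<lfloor>v\<rfloor> - 1" by linarith
  ultimately show ?thesis
    by (auto simp: rotate_residue_def unrotate_residue_def)
qed

lemma floor_rotate_residue:
  "\<lfloor>rotate_residue m v\<rfloor> mod int m = (\<lfloor>v\<rfloor> mod int m + 1) mod int m"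
proof -
  have "\<lfloor>v + 1 - real m\<rfloor> = \<lfloor>v\<rfloor> + 1 - int m" by linarith
  moreover have "\<lfloor>v + 1\<rfloor> = \<lfloor>v\<rfloor> + 1" by linarith
  ultimately show ?thesis
    by (auto simp: rotate_residue_def mod_add_left_eq)
qed

lemma rotate_residue_of_nat:
  assumes "k < m" shows "rotate_residue m (real k) = real ((k + 1) mod m)"
proof (cases "k + 1 = m")
  case True
  then have *: "int k + 1 = int m" "real k + 1 = real m" "(k + 1) mod m = 0" by auto
  show ?thesis unfolding rotate_residue_def floor_of_nat * by simp
next
  case False
  then have "k + 1 < m" using assms by simp
  moreover from this have "(int k + 1) mod int m \<noteq> 0"
    by (metis add_is_0 mod_less of_nat_0_eq_iff of_nat_1 of_nat_add one_neq_zero zmod_int)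
  ultimately show ?thesis by (simp add: rotate_residue_def)
qed

lemma bij_betw_add1_mod:
  assumes "m > 0" shows "bij_betw (\<lambda>k. (k + 1) mod m) {..<m} {..<m::nat}"
proof -
  have "inj_on (\<lambda>k. (k + 1) mod m) {..<m}"
  proof (rule inj_onI)
    fix x y assume *: "x \<in> {..<m}" "y \<in> {..<m}" "(x + 1) mod m = (y + 1) mod m"
    then have "[x + 1 = y + 1] (mod m)" by (simp add: cong_def)
    then have "[x = y] (mod m)" by (simp only: cong_add_rcancel_nat)
    then show "x = y" using * by (simp add: cong_def)
  qed
  moreover have "(\<lambda>k. (k + 1) mod m) ` {..<m} \<subseteq> {..<m}" using assms by auto
  ultimately show ?thesis
    by (simp add: bij_betw_def endo_inj_surj)
qed

section \<open>Averages of sequences\<close>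

definition cesaro :: "(nat \<Rightarrow> 'a :: real_normed_field) \<Rightarrow> nat \<Rightarrow> 'a" where
  "cesaro b N = (\<Sum>n=1..N. b n) / of_nat N"

lemma cesaro_diff: "cesaro b N - cesaro c N = cesaro (\<lambda>n. b n - c n) N"
  by (simp add: cesaro_def sum_subtractf diff_divide_distrib)

lemma cesaro_norm_le:
  assumes "\<And>n. norm (b n) \<le> e" shows "norm (cesaro b N) \<le> e"
proof (cases "N = 0")
  case True
  have "0 \<le> e" using assms[of 0] norm_ge_zero order_trans by blast
  then show ?thesis using True by (simp add: cesaro_def)
next
  case False
  have "norm (\<Sum>n=1..N. b n) \<le> real (card {1..N}) * e"
    by (rule sum_norm_bound) (rule assms)
  then show ?thesis using False by (simp add: cesaro_def norm_divide field_simps)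
qed

lemma cesaro_norm_diff_le:
  "(\<And>n. norm (b n - c n) \<le> e) \<Longrightarrow> norm (cesaro b N - cesaro c N) \<le> e"
  unfolding cesaro_diff by (rule cesaro_norm_le)

lemma cesaro_tendsto_0:
  assumes "\<And>N. norm (\<Sum>n=1..N. b n) \<le> K"
  shows "cesaro b \<longlonglongrightarrow> 0"
proof (rule Lim_null_comparison)
  show "(\<lambda>N. K / real N) \<longlonglongrightarrow> 0" by (rule lim_const_over_n)
  show "\<forall>\<^sub>F N in sequentially. norm (cesaro b N) \<le> K / real N"
    using assms by (intro always_eventually allI) (simp add: cesaro_def norm_divide divide_right_mono)
qed

text \<open>Finitely many terms contribute a bounded amount to the partial sums.\<close>

lemma cesaro_eventually_eq:
  assumes "\<And>n. n \<ge> n0 \<Longrightarrow> b n = c n" and c: "cesaro c \<longlonglongrightarrow> L"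
  shows "cesaro b \<longlonglongrightarrow> L"
proof -
  have "norm (\<Sum>n=1..N. b n - c n) \<le> (\<Sum>n<n0. norm (b n - c n))" for N
  proof -
    have "norm (\<Sum>n=1..N. b n - c n) \<le> (\<Sum>n=1..N. norm (b n - c n))" by (rule norm_sum)
    also have "\<dots> = (\<Sum>n\<in>{1..N} \<inter> {..<n0}. norm (b n - c n))"
    proof (intro sum.mono_neutral_right ballI)
      fix n assume "n \<in> {1..N} - {1..N} \<inter> {..<n0}"
      then show "norm (b n - c n) = 0" using assms(1)[of n] by auto
    qed auto
    also have "\<dots> \<le> (\<Sum>n<n0. norm (b n - c n))" by (intro sum_mono2) auto
    finally show ?thesis .
  qed
  then have "cesaro (\<lambda>n. b n - c n) \<longlonglongrightarrow> 0" by (rule cesaro_tendsto_0)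
  from tendsto_add[OF this c] show ?thesis by (simp add: cesaro_diff[symmetric])
qed

lemma sum_periodic_shift:
  fixes b :: "nat \<Rightarrow> 'b :: comm_monoid_add"
  assumes "\<And>n. b (n + m) = b n"
  shows "(\<Sum>n<m. b (n + k)) = (\<Sum>n<m. b n)"
proof (induction k)
  case (Suc k)
  have "(\<Sum>n<m. b (n + Suc k)) = (\<Sum>n<m. b (n + k))"
  proof (cases m)
    case (Suc l)
    have "(\<Sum>n<Suc l. b (n + Suc k)) = (\<Sum>n<l. b (Suc n + k)) + b (k + m)"
      by (simp add: Suc add.commute)
    also have "\<dots> = b (0 + k) + (\<Sum>n<l. b (Suc n + k))" using assms[of k] by (simp add: add.commute)
    also have "\<dots> = (\<Sum>n<Suc l. b (n + k))" by (rule sum.lessThan_Suc_shift[symmetric])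
    finally show ?thesis using Suc by simp
  qed simp
  then show ?case using Suc by simp
qed simp

lemma sum_periodic_Suc:
  fixes b :: "nat \<Rightarrow> 'a :: real_normed_field"
  assumes "\<And>n. b (n + m) = b n"
  shows "(\<Sum>n=1..N + m. b n) = (\<Sum>n=1..N. b n) + (\<Sum>n<m. b n)"
proof -
  have "(\<Sum>n=1..N + m. b n) = (\<Sum>n=1..N. b n) + (\<Sum>n=N+1..N + m. b n)"
    by (rule sum.ub_add_nat) simp
  also have "(\<Sum>n=N+1..N + m. b n) = (\<Sum>n<m. b (n + (N + 1)))"
    by (rule sum.reindex_bij_witness[of _ "\<lambda>n. n + (N + 1)" "\<lambda>n. n - (N + 1)"]) auto
  also have "\<dots> = (\<Sum>n<m. b n)" by (rule sum_periodic_shift) (rule assms)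
  finally show ?thesis .
qed

text \<open>After the mean over a period is subtracted, the partial sums are periodic as well, hence bounded.\<close>

lemma cesaro_periodic:
  assumes per: "\<And>n. b (n + m) = b n" and "m > 0"
  shows "cesaro b \<longlonglongrightarrow> (\<Sum>n<m. b n) / of_nat m"
proof -
  define L where "L = (\<Sum>n<m. b n) / of_nat m"
  define S where "S N = (\<Sum>n=1..N. b n - L)" for N
  have "(\<Sum>n<m. b n - L) = 0" using \<open>m > 0\<close> by (simp add: sum_subtractf L_def)
  then have S: "S (N + m) = S N" for N
    unfolding S_def by (subst sum_periodic_Suc) (simp_all add: per)
  have S': "S (k * m + N) = S N" for k N
  proof (induction k)
    case (Suc k)
    then show ?case using S[of "k * m + N"] by (simp add: ac_simps)
  qed simp
  have "norm (S N) \<le> Max ((\<lambda>n. norm (S n)) ` {..<m})" for N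
  proof -
    have "S N = S (N mod m)" using S'[of "N div m" "N mod m"] by simp
    then show ?thesis using \<open>m > 0\<close> by auto
  qed
  then have "cesaro (\<lambda>n. b n - L) \<longlonglongrightarrow> 0" unfolding S_def by (rule cesaro_tendsto_0)
  moreover have "cesaro (\<lambda>n. L) \<longlonglongrightarrow> L"
  proof (rule tendsto_eventually)
    show "\<forall>\<^sub>F N in sequentially. cesaro (\<lambda>n. L) N = L"
      using eventually_gt_at_top[of 0] by eventually_elim (simp add: cesaro_def)
  qed
  ultimately have "(\<lambda>N. cesaro (\<lambda>n. b n - L) N + cesaro (\<lambda>n. L) N) \<longlonglongrightarrow> 0 + L" by (rule tendsto_add)
  then show ?thesis by (simp add: cesaro_diff[symmetric] L_def)
qed

lemma convergent_by_approximation: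
  fixes X :: "nat \<Rightarrow> 'a :: banach"
  assumes "\<And>\<epsilon>. \<epsilon> > 0 \<Longrightarrow> \<exists>Y. convergent Y \<and> (\<forall>n. norm (X n - Y n) \<le> \<epsilon>)"
  shows "convergent X"
proof (rule Cauchy_convergent, rule CauchyI)
  fix e :: real assume "e > 0"
  then obtain Y where Y: "convergent Y" "\<And>n. norm (X n - Y n) \<le> e / 4"
    using assms[of "e / 4"] by auto
  obtain N where N: "\<And>m n. m \<ge> N \<Longrightarrow> n \<ge> N \<Longrightarrow> norm (Y m - Y n) < e / 4"
    using CauchyD[OF convergent_Cauchy[OF Y(1)], of "e / 4"] \<open>e > 0\<close> by auto
  have "norm (X m - X n) < e" if "m \<ge> N" "n \<ge> N" for m n
  proof -
    have "X m - X n = (X m - Y m) + (Y m - Y n) - (X n - Y n)" by simp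
    also have "norm \<dots> \<le> norm (X m - Y m) + norm (Y m - Y n) + norm (X n - Y n)"
      by (intro order_trans[OF norm_triangle_ineq4] add_right_mono norm_triangle_ineq)
    also have "\<dots> < e" using Y(2)[of m] Y(2)[of n] N[OF that] \<open>e > 0\<close> by linarith
    finally show ?thesis .
  qed
  then show "\<exists>M. \<forall>m\<ge>M. \<forall>n\<ge>M. norm (X m - X n) < e" by blast
qed

lemma tendsto_by_approximation:
  fixes X :: "nat \<Rightarrow> 'a :: real_normed_vector"
  assumes "\<And>\<epsilon>. \<epsilon> > 0 \<Longrightarrow> \<exists>Y l. Y \<longlonglongrightarrow> l \<and> (\<forall>n. norm (X n - Y n) \<le> \<epsilon>) \<and> norm (L - l) \<le> \<epsilon>"
  shows "X \<longlonglongrightarrow> L"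
proof (rule LIMSEQ_I)
  fix e :: real assume "e > 0"
  then obtain Y l where Y: "Y \<longlonglongrightarrow> l" "\<And>n. norm (X n - Y n) \<le> e / 4" "norm (L - l) \<le> e / 4"
    using assms[of "e / 4"] by auto
  obtain N where N: "\<And>n. n \<ge> N \<Longrightarrow> norm (Y n - l) < e / 4"
    using LIMSEQ_D[OF Y(1), of "e / 4"] \<open>e > 0\<close> by auto
  have "norm (X n - L) < e" if "n \<ge> N" for n
  proof -
    have "X n - L = (X n - Y n) + (Y n - l) - (L - l)" by simp
    also have "norm \<dots> \<le> norm (X n - Y n) + norm (Y n - l) + norm (L - l)"
      by (intro order_trans[OF norm_triangle_ineq4] add_right_mono norm_triangle_ineq)
    also have "\<dots> < e" using Y(2)[of n] Y(3) N[OF that] \<open>e > 0\<close> by linarith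
    finally show ?thesis .
  qed
  then show "\<exists>N. \<forall>n\<ge>N. norm (X n - L) < e" by blast
qed

lemma cesaro_square_le: "(cesaro b N)\<^sup>2 \<le> cesaro (\<lambda>n. (b n)\<^sup>2) N" for b :: "nat \<Rightarrow> real"
proof (cases "N = 0")
  case False
  have "(\<Sum>n=1..N. b n)\<^sup>2 \<le> (\<Sum>n=1..N. (b n)\<^sup>2) * real N"
    using sum_squared_le_sum_of_squares[of b "{1..N}"] by simp
  then have "(\<Sum>n=1..N. b n)\<^sup>2 / (real N)\<^sup>2 \<le> (\<Sum>n=1..N. (b n)\<^sup>2) * real N / (real N)\<^sup>2"
    by (rule divide_right_mono) simp
  also have "\<dots> = cesaro (\<lambda>n. (b n)\<^sup>2) N" using False by (simp add: cesaro_def power2_eq_square)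
  finally show ?thesis by (simp add: cesaro_def power_divide)
qed (simp add: cesaro_def)

lemma mult_divide_add1_le: "K * (e / (K + 1)) \<le> e" if "K \<ge> 0" "e \<ge> 0" for K e :: real
proof -
  have "K * e \<le> e * (K + 1)" using that by (simp add: algebra_simps)
  then show ?thesis using that(1) by (simp add: divide_le_eq)
qed

lemma cesaro_mono: "(\<And>n. b n \<le> c n) \<Longrightarrow> cesaro b N \<le> cesaro c N" for b :: "nat \<Rightarrow> real"
  by (simp add: cesaro_def sum_mono divide_right_mono)

lemma cmod_cesaro_le: "cmod (cesaro b N) \<le> cesaro (\<lambda>n. cmod (b n)) N"
  by (simp add: cesaro_def norm_divide norm_sum divide_right_mono)

section \<open>A product of finite rotations with a Bernoulli shift\<close>

text \<open>The coordinates with an odd index carry the rotations, those with an even index carry the random bits.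
Coprimality makes the product of the rotations ergodic.\<close>

locale coprime_rotations =
  fixes s :: "int \<Rightarrow> nat"
  assumes s_pos: "s i > 0"
    and s_even: "even i \<Longrightarrow> s i = 2"
    and s_coprime: "odd i \<Longrightarrow> odd j \<Longrightarrow> i \<noteq> j \<Longrightarrow> coprime (s i) (s j)"
begin

definition digit :: "int \<Rightarrow> nat measure" where
  "digit i = measure_pmf (pmf_of_set {..<s i})"

definition digits :: "(int \<Rightarrow> nat) measure" where
  "digits = PiM UNIV digit"

definition embed :: "(int \<Rightarrow> nat) \<Rightarrow> point" where
  "embed u = (0, \<lambda>i. real (u i))"

text \<open>The system lives on the second component of a point; the first component is almost surely \<open>0\<close>.\<close>

definition M :: "point measure" where
  "M = distr digits borel embed"

definition res :: "int \<Rightarrow> point \<Rightarrow> nat" where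
  "res i p = nat (\<lfloor>snd p i\<rfloor> mod int (s i))"

definition T :: "point \<Rightarrow> point" where
  "T p = (fst p, \<lambda>i. if even i then snd p (i + 2) else rotate_residue (s i) (snd p i))"

definition T_inv :: "point \<Rightarrow> point" where
  "T_inv p = (fst p, \<lambda>i. if even i then snd p (i - 2) else unrotate_residue (s i) (snd p i))"

text \<open>The point with the coordinates of \<open>p\<close> in \<open>S\<close> and those of \<open>q\<close> elsewhere. Since all coordinates are
independent, joining two independent random points yields a random point with the same distribution.\<close>

definition join :: "int set \<Rightarrow> point \<Rightarrow> point \<Rightarrow> point" where
  "join S p q = (fst p, \<lambda>i. if i \<in> S then snd p i else snd q i)"

sublocale digits: product_prob_space digit UNIV
  by (rule product_prob_spaceI) (simp add: digit_def measure_pmf.prob_space_axioms)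

lemma sets_digit [simp]: "sets (digit i) = UNIV" and space_digit [simp]: "space (digit i) = UNIV"
  by (auto simp: digit_def)

lemma sets_digits: "sets digits = sets (PiM UNIV (\<lambda>_. count_space UNIV))"
  unfolding digits_def by (intro sets_PiM_cong) auto

lemma space_digits [simp]: "space digits = UNIV"
  by (simp add: digits_def space_PiM)

lemma digit_component_measurable [measurable]: "(\<lambda>u. u i) \<in> digits \<rightarrow>\<^sub>M count_space UNIV"
proof -
  have "(\<lambda>u. u i) \<in> PiM UNIV (\<lambda>_. count_space UNIV :: nat measure) \<rightarrow>\<^sub>M count_space UNIV" by measurable
  then show ?thesis using measurable_cong_sets[OF sets_digits refl] by blast
qed

lemma measurable_into_digits:
  assumes "\<And>i. (\<lambda>x. f x i) \<in> X \<rightarrow>\<^sub>M count_space UNIV"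
  shows "f \<in> X \<rightarrow>\<^sub>M digits"
proof -
  have "f \<in> X \<rightarrow>\<^sub>M PiM UNIV (\<lambda>_. count_space UNIV :: nat measure)"
    by (rule measurable_PiM_single') (use assms in auto)
  then show ?thesis using measurable_cong_sets[OF refl sets_digits] by blast
qed

lemma embed_measurable [measurable]: "embed \<in> digits \<rightarrow>\<^sub>M borel"
  unfolding embed_def
  by (intro borel_measurable_Pair measurable_coordinatewise_then_product) measurable

lemma prob_space_digits: "prob_space digits"
  unfolding digits_def by (rule digits.P.prob_space_axioms)

sublocale D: prob_space digits
  by (rule prob_space_digits)

sublocale prob_space M
  unfolding M_def by (rule prob_space.prob_space_distr[OF prob_space_digits]) simp

lemma sets_M [simp, measurable_cong]: "sets M = sets borel" and space_M [simp]: "space M = UNIV"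
  by (auto simp: M_def)

lemma coordinate_measurable [measurable]: "(\<lambda>p. snd p (i::int)) \<in> borel_measurable (borel :: point measure)"
  by (rule borel_measurable_continuous_onI) (auto intro!: continuous_intros continuous_on_product_coordinates continuous_on_compose2[OF continuous_on_product_coordinates continuous_on_snd])

lemma fst_point_measurable [measurable]: "fst \<in> borel_measurable (borel :: point measure)"
  by (intro borel_measurable_continuous_onI continuous_intros)

lemma rotate_residue_measurable [measurable]: "rotate_residue m \<in> borel_measurable borel"
  unfolding rotate_residue_def by measurable

lemma unrotate_residue_measurable [measurable]: "unrotate_residue m \<in> borel_measurable borel"
  unfolding unrotate_residue_def by measurable

lemma T_measurable [measurable]: "T \<in> borel_measurable borel"
  unfolding T_def by (intro borel_measurable_Pair measurable_coordinatewise_then_product) measurable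

lemma T_inv_measurable [measurable]: "T_inv \<in> borel_measurable borel"
  unfolding T_inv_def by (intro borel_measurable_Pair measurable_coordinatewise_then_product) measurable

lemma join_measurable [measurable]:
  "(\<lambda>x. join S (fst x) (snd x)) \<in> borel_measurable (borel \<Otimes>\<^sub>M borel)"
proof -
  have [measurable]: "(\<lambda>x :: point \<times> point. snd (fst x) i) \<in> borel_measurable (borel \<Otimes>\<^sub>M borel)"
      "(\<lambda>x :: point \<times> point. snd (snd x) i) \<in> borel_measurable (borel \<Otimes>\<^sub>M borel)"
      "(\<lambda>x :: point \<times> point. fst (fst x)) \<in> borel_measurable (borel \<Otimes>\<^sub>M borel)"
    for i :: int
    by (rule measurable_compose[OF measurable_fst coordinate_measurable]
      measurable_compose[OF measurable_snd coordinate_measurable]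
      measurable_compose[OF measurable_fst fst_point_measurable])+
  show ?thesis
    unfolding join_def by (intro borel_measurable_Pair measurable_coordinatewise_then_product) measurable
qed

lemma res_measurable [measurable]: "res i \<in> borel \<rightarrow>\<^sub>M count_space UNIV"
  unfolding res_def by measurable

lemma T_T_inv [simp]: "T (T_inv p) = p" and T_inv_T [simp]: "T_inv (T p) = p"
  by (auto simp: T_def T_inv_def unrotate_rotate rotate_unrotate prod_eq_iff fun_eq_iff)

lemma bij_T: "bij T"
  by (rule bij_betw_byWitness[where f' = T_inv]) auto

lemma join_T: "join {i. odd i} (T p) (T q) = T (join {i. odd i} p q)"
  by (auto simp: join_def T_def fun_eq_iff)

lemma res_less: "res i p < s i"
  using s_pos[of i] by (simp add: res_def nat_less_iff)

lemma res_T_even: "even i \<Longrightarrow> res i (T p) = res (i + 2) p"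
  by (simp add: res_def T_def s_even)

lemma res_T_odd: "odd i \<Longrightarrow> res i (T p) = (res i p + 1) mod s i"
  using s_pos[of i] by (simp add: res_def T_def floor_rotate_residue nat_mod_distrib nat_add_distrib add.commute)

lemma res_join: "res i (join S p q) = (if i \<in> S then res i p else res i q)"
  by (auto simp: res_def join_def)

lemma AE_digits_less: "AE u in digits. u i < s i"
proof -
  have "AE k in digit i. k < s i"
    unfolding digit_def AE_measure_pmf_iff using s_pos[of i] by (subst set_pmf_of_set) (auto simp: lessThan_empty_iff)
  then show ?thesis unfolding digits_def by (rule digits.AE_component[rotated]) simp
qed

lemma AE_digits_all_less: "AE u in digits. \<forall>i. u i < s i"
  by (subst AE_all_countable) (auto intro: AE_digits_less)

lemma AE_M_iff: "Measurable.pred borel P \<Longrightarrow> (AE p in M. P p) \<longleftrightarrow> (AE u in digits. P (embed u))"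
  unfolding M_def by (subst AE_distr_iff) auto

lemma AE_fst: "AE p in M. fst p = 0"
proof (subst AE_M_iff)
  show "Measurable.pred borel (\<lambda>p::point. fst p = 0)" by measurable
qed (simp add: embed_def)

lemma AE_coordinate: "AE p in M. snd p i = real (res i p)"
proof (subst AE_M_iff)
  show "AE u in digits. snd (embed u) i = real (res i (embed u))"
    using AE_digits_less[of i] by eventually_elim (simp add: embed_def res_def nat_mod_distrib)
qed measurable

lemma digits_eqI:
  assumes sets: "sets Q = sets digits"
    and eq: "\<And>J A. finite J \<Longrightarrow> emeasure Q {u. \<forall>i\<in>J. u i \<in> A i} = (\<Prod>i\<in>J. emeasure (digit i) (A i))"
  shows "Q = digits"
  unfolding digits_def
proof (rule digits.PiM_eq)
  show "sets Q = sets (PiM UNIV digit)" using sets by (simp add: digits_def)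
  fix J :: "int set" and F :: "int \<Rightarrow> nat set"
  assume "finite J"
  have "prod_emb UNIV digit J (PiE J F) = {u. \<forall>i\<in>J. u i \<in> F i}"
    by (auto simp: prod_emb_def space_PiM PiE_iff)
  then show "emeasure Q (prod_emb UNIV digit J (PiE J F)) = (\<Prod>j\<in>J. emeasure (digit j) (F j))"
    using eq[OF \<open>finite J\<close>] by simp
qed

lemma emeasure_digits_cylinder:
  assumes "finite J"
  shows "emeasure digits {u. \<forall>i\<in>J. u i \<in> A i} = (\<Prod>i\<in>J. emeasure (digit i) (A i))"
  using digits.emeasure_PiM_Collect[of J A] assms by (simp add: digits_def[symmetric])

lemma cylinder_in_sets_digits:
  assumes "finite J" shows "{u. \<forall>i\<in>J. u i \<in> A i} \<in> sets digits"
proof -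
  have "{u \<in> space digits. u i \<in> A i} \<in> sets digits" for i
    using measurable_sets[OF digit_component_measurable, of "A i" i] by (simp add: vimage_def)
  then have "{u \<in> space digits. \<forall>i\<in>J. u i \<in> A i} \<in> sets digits"
    by (intro sets.sets_Collect_finite_All assms)
  then show ?thesis by simp
qed

definition digit_shift :: "(int \<Rightarrow> nat) \<Rightarrow> int \<Rightarrow> nat" where
  "digit_shift u i = (if even i then u (i + 2) else (u i + 1) mod s i)"

lemma digit_shift_measurable [measurable]: "digit_shift \<in> digits \<rightarrow>\<^sub>M digits"
  by (rule measurable_into_digits) (simp add: digit_shift_def)

lemma emeasure_digit_rotate:
  "emeasure (digit i) {k. (k + 1) mod s i \<in> A} = emeasure (digit i) A"
proof -
  have "map_pmf (\<lambda>k. (k + 1) mod s i) (pmf_of_set {..<s i}) = pmf_of_set {..<s i}"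
    using s_pos[of i] by (intro map_pmf_of_set_bij_betw bij_betw_add1_mod) (auto simp: lessThan_empty_iff)
  then have "emeasure (digit i) A = emeasure (map_pmf (\<lambda>k. (k + 1) mod s i) (pmf_of_set {..<s i})) A"
    by (simp add: digit_def)
  then show ?thesis by (simp add: digit_def vimage_def)
qed

lemma distr_digit_shift: "distr digits digits digit_shift = digits"
proof (rule digits_eqI)
  fix J :: "int set" and A :: "int \<Rightarrow> nat set" assume J: "finite J"
  define \<tau> where "\<tau> i = (if even i then i + 2 else i)" for i :: int
  define A' where "A' i = (if even i then A (i - 2) else {k. (k + 1) mod s i \<in> A i})" for i
  have inj: "inj_on \<tau> J" by (auto simp: inj_on_def \<tau>_def split: if_splits)
  have **: "u (\<tau> j) \<in> A' (\<tau> j) \<longleftrightarrow> digit_shift u j \<in> A j" for u j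
    by (simp add: digit_shift_def \<tau>_def A'_def)
  have *: "digit_shift -` {u. \<forall>i\<in>J. u i \<in> A i} \<inter> space digits = {u. \<forall>i\<in>\<tau> ` J. u i \<in> A' i}"
    by (simp add: ** vimage_def)
  have "emeasure (distr digits digits digit_shift) {u. \<forall>i\<in>J. u i \<in> A i}
      = emeasure digits {u. \<forall>i\<in>\<tau> ` J. u i \<in> A' i}"
    unfolding *[symmetric] by (intro emeasure_distr digit_shift_measurable cylinder_in_sets_digits J)
  also have "\<dots> = (\<Prod>i\<in>\<tau> ` J. emeasure (digit i) (A' i))"
    using J by (intro emeasure_digits_cylinder) simp
  also have "\<dots> = (\<Prod>j\<in>J. emeasure (digit (\<tau> j)) (A' (\<tau> j)))"
    by (rule prod.reindex[OF inj, unfolded o_def])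
  also have "\<dots> = (\<Prod>j\<in>J. emeasure (digit j) (A j))"
    using emeasure_digit_rotate by (intro prod.cong refl) (auto simp: \<tau>_def A'_def digit_def s_even)
  finally show "emeasure (distr digits digits digit_shift) {u. \<forall>i\<in>J. u i \<in> A i} = \<dots>" .
qed simp

lemma distr_T: "distr M M T = M"
proof -
  have "distr M M T = distr M borel T" by (rule distr_cong) auto
  also have "\<dots> = distr digits borel (\<lambda>u. T (embed u))"
    unfolding M_def by (subst distr_distr) (auto simp: o_def)
  also have "\<dots> = distr digits borel (\<lambda>u. embed (digit_shift u))"
  proof (rule distr_cong_AE)
    show "AE u in digits. T (embed u) = embed (digit_shift u)"
      using AE_digits_all_less
      by eventually_elim (auto simp: T_def embed_def digit_shift_def fun_eq_iff rotate_residue_of_nat)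
  qed auto
  also have "\<dots> = distr (distr digits digits digit_shift) borel embed"
    by (subst distr_distr) (auto simp: o_def)
  finally show ?thesis by (simp add: distr_digit_shift M_def)
qed

definition digit_join :: "int set \<Rightarrow> (int \<Rightarrow> nat) \<times> (int \<Rightarrow> nat) \<Rightarrow> int \<Rightarrow> nat" where
  "digit_join S x i = (if i \<in> S then fst x i else snd x i)"

lemma digit_join_measurable [measurable]: "digit_join S \<in> digits \<Otimes>\<^sub>M digits \<rightarrow>\<^sub>M digits"
proof (rule measurable_into_digits)
  fix i
  have "(\<lambda>x. fst x i) \<in> digits \<Otimes>\<^sub>M digits \<rightarrow>\<^sub>M count_space UNIV"
    "(\<lambda>x. snd x i) \<in> digits \<Otimes>\<^sub>M digits \<rightarrow>\<^sub>M count_space UNIV"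
    by (rule measurable_compose[OF measurable_fst digit_component_measurable]
          measurable_compose[OF measurable_snd digit_component_measurable])+
  then show "(\<lambda>x. digit_join S x i) \<in> digits \<Otimes>\<^sub>M digits \<rightarrow>\<^sub>M count_space UNIV"
    by (cases "i \<in> S") (simp_all add: digit_join_def)
qed

lemma distr_digit_join: "distr (digits \<Otimes>\<^sub>M digits) digits (digit_join S) = digits"
proof (rule digits_eqI)
  fix J :: "int set" and A :: "int \<Rightarrow> nat set" assume J: "finite J"
  have *: "digit_join S -` {u. \<forall>i\<in>J. u i \<in> A i} \<inter> space (digits \<Otimes>\<^sub>M digits)
      = {u. \<forall>i\<in>J \<inter> S. u i \<in> A i} \<times> {u. \<forall>i\<in>J - S. u i \<in> A i}"
    by (auto simp: digit_join_def space_pair_measure)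
  have "emeasure (distr (digits \<Otimes>\<^sub>M digits) digits (digit_join S)) {u. \<forall>i\<in>J. u i \<in> A i}
      = emeasure (digits \<Otimes>\<^sub>M digits) ({u. \<forall>i\<in>J \<inter> S. u i \<in> A i} \<times> {u. \<forall>i\<in>J - S. u i \<in> A i})"
    unfolding *[symmetric] by (intro emeasure_distr digit_join_measurable cylinder_in_sets_digits J)
  also have "\<dots> = emeasure digits {u. \<forall>i\<in>J \<inter> S. u i \<in> A i} * emeasure digits {u. \<forall>i\<in>J - S. u i \<in> A i}"
    using J by (intro D.emeasure_pair_measure_Times cylinder_in_sets_digits) auto
  also have "\<dots> = (\<Prod>i\<in>J \<inter> S. emeasure (digit i) (A i)) * (\<Prod>i\<in>J - S. emeasure (digit i) (A i))"
    using J by (simp add: emeasure_digits_cylinder)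
  also have "\<dots> = (\<Prod>i\<in>J. emeasure (digit i) (A i))"
    using J by (simp add: prod.Int_Diff[symmetric])
  finally show "emeasure (distr (digits \<Otimes>\<^sub>M digits) digits (digit_join S)) {u. \<forall>i\<in>J. u i \<in> A i} = \<dots>" .
qed simp

lemma distr_join: "distr (M \<Otimes>\<^sub>M M) borel (\<lambda>x. join S (fst x) (snd x)) = M"
proof -
  have m: "(\<lambda>x. join S (fst x) (snd x)) \<in> borel \<Otimes>\<^sub>M borel \<rightarrow>\<^sub>M borel" by measurable
  have "M \<Otimes>\<^sub>M M = distr (digits \<Otimes>\<^sub>M digits) (borel \<Otimes>\<^sub>M borel) (\<lambda>(x, y). (embed x, embed y))"
    unfolding M_def
    by (rule pair_measure_distr) (use sigma_finite_measure_axioms in \<open>auto simp: M_def\<close>)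
  then have "distr (M \<Otimes>\<^sub>M M) borel (\<lambda>x. join S (fst x) (snd x))
      = distr (digits \<Otimes>\<^sub>M digits) borel (\<lambda>x. join S (embed (fst x)) (embed (snd x)))"
    using m by (simp add: distr_distr o_def split_beta)
  also have "\<dots> = distr (digits \<Otimes>\<^sub>M digits) borel (\<lambda>x. embed (digit_join S x))"
    by (intro distr_cong) (auto simp: join_def embed_def digit_join_def fun_eq_iff)
  also have "\<dots> = distr (distr (digits \<Otimes>\<^sub>M digits) digits (digit_join S)) borel embed"
    by (subst distr_distr) (auto simp: o_def)
  finally show ?thesis by (simp add: distr_digit_join M_def)
qed

lemma measure_cylinder:
  assumes "finite J" and v: "\<And>i. i \<in> J \<Longrightarrow> v i < s i"
  shows "measure M {p. \<forall>i\<in>J. res i p = v i} = (\<Prod>i\<in>J. 1 / real (s i))"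
proof -
  have m: "{p. \<forall>i\<in>J. res i p = v i} \<in> sets (borel :: point measure)"
    using \<open>finite J\<close> by measurable
  have "embed -` {p. \<forall>i\<in>J. res i p = v i} \<inter> space digits = {u. \<forall>i\<in>J. u i \<in> {k. k mod s i = v i}}"
    by (simp add: res_def embed_def vimage_def nat_mod_distrib)
  then have "emeasure M {p. \<forall>i\<in>J. res i p = v i}
      = emeasure digits {u. \<forall>i\<in>J. u i \<in> {k. k mod s i = v i}}"
    unfolding M_def using m by (simp only: emeasure_distr embed_measurable)
  also have "\<dots> = (\<Prod>i\<in>J. emeasure (digit i) {k. k mod s i = v i})"
    by (rule emeasure_digits_cylinder) fact
  also have "\<dots> = (\<Prod>i\<in>J. ennreal (1 / real (s i)))"
  proof (intro prod.cong refl)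
    fix i assume "i \<in> J"
    have "{..<s i} \<inter> {k. k mod s i = v i} = {v i}" using v[OF \<open>i \<in> J\<close>] by auto
    moreover have "{..<s i} \<noteq> {}" using s_pos[of i] by (auto simp: lessThan_empty_iff)
    ultimately show "emeasure (digit i) {k. k mod s i = v i} = ennreal (1 / real (s i))"
      unfolding digit_def by (subst emeasure_pmf_of_set) auto
  qed
  finally show ?thesis
    by (simp add: emeasure_eq_measure prod_ennreal measure_nonneg prod_nonneg)
qed

section \<open>Functions of finitely many coordinates\<close>

text \<open>Quantifiers over points must not be split into their components, since the coordinates are accessed
only through \<open>res\<close>.\<close>

declare split_paired_All [simp del] split_paired_Ex [simp del]

lemma prob_UNIV [simp]: "prob UNIV = 1"
  using prob_space by simp

text \<open>Boundedness is required everywhere, so that sections of functions of two variables stay bounded.\<close>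

definition bounded_fun :: "real \<Rightarrow> (point \<Rightarrow> complex) \<Rightarrow> bool" where
  "bounded_fun C f \<longleftrightarrow> f \<in> borel_measurable borel \<and> (\<forall>p. cmod (f p) \<le> C)"

lemma bounded_fun_measurable: "bounded_fun C f \<Longrightarrow> f \<in> borel_measurable borel"
  by (simp add: bounded_fun_def)

lemma bounded_fun_integrable: "bounded_fun C f \<Longrightarrow> integrable M f"
  by (rule integrable_const_bound[where B = C]) (auto simp: bounded_fun_def)

lemma bounded_fun_nonneg: "bounded_fun C f \<Longrightarrow> 0 \<le> C"
  unfolding bounded_fun_def by (meson norm_ge_zero order_trans)

lemma bounded_fun_cnj: "bounded_fun C f \<Longrightarrow> bounded_fun C (\<lambda>p. cnj (f p))"
  unfolding bounded_fun_def
  by (auto intro: measurable_compose[OF _ borel_measurable_continuous_onI[OF continuous_on_cnj[OF continuous_on_id]]])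

lemma bounded_fun_mult:
  "bounded_fun C f \<Longrightarrow> bounded_fun D g \<Longrightarrow> bounded_fun (C * D) (\<lambda>p. f p * g p)"
  unfolding bounded_fun_def
  by (auto simp: norm_mult intro!: mult_mono borel_measurable_times dest: order_trans[OF norm_ge_zero])

lemma T_pow_measurable [measurable]: "(T ^^ n) \<in> borel_measurable borel"
  by (induction n) (auto intro: measurable_comp)

lemma bounded_fun_comp:
  "bounded_fun C f \<Longrightarrow> X \<in> borel_measurable borel \<Longrightarrow> bounded_fun C (\<lambda>p. f (X p))"
  unfolding bounded_fun_def by (auto intro: measurable_compose)

lemma bounded_fun_T_pow: "bounded_fun C f \<Longrightarrow> bounded_fun C (\<lambda>p. f ((T ^^ n) p))"
  by (rule bounded_fun_comp) measurable

lemma integral_T_pow: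
  fixes f :: "point \<Rightarrow> 'b :: {banach, second_countable_topology}"
  assumes [measurable]: "f \<in> borel_measurable borel"
  shows "(\<integral>p. f ((T ^^ n) p) \<partial>M) = (\<integral>p. f p \<partial>M)"
proof (induction n)
  case (Suc n)
  have "(\<integral>p. f ((T ^^ Suc n) p) \<partial>M) = (\<integral>p. f ((T ^^ n) (T p)) \<partial>M)"
    by (simp add: funpow_swap1)
  also have "\<dots> = (\<integral>p. f ((T ^^ n) p) \<partial>distr M M T)"
    by (rule integral_distr[symmetric]) auto
  finally show ?case by (simp add: distr_T Suc)
qed simp

lemma AE_T_pow:
  assumes "AE p in M. P p" shows "AE p in M. P ((T ^^ n) p)"
proof (induction n)
  case (Suc n)
  have "AE p in distr M M T. P ((T ^^ n) p)" using Suc unfolding distr_T .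
  then have "AE p in M. P ((T ^^ n) (T p))" by (rule AE_distrD[rotated]) auto
  then show ?case by (simp add: funpow_swap1)
qed (use assms in simp)

lemma bounded_fun_join:
  assumes "bounded_fun C f"
  shows "bounded_fun C (\<lambda>q. f (join S p q))" "(\<lambda>x. f (join S (fst x) (snd x))) \<in> borel_measurable (borel \<Otimes>\<^sub>M borel)"
proof -
  show m: "(\<lambda>x. f (join S (fst x) (snd x))) \<in> borel_measurable (borel \<Otimes>\<^sub>M borel)"
    by (rule measurable_compose[OF join_measurable]) (use assms in \<open>simp add: bounded_fun_def\<close>)
  have "(\<lambda>q. (p, q)) \<in> borel \<rightarrow>\<^sub>M borel \<Otimes>\<^sub>M borel" by measurable
  from measurable_compose[OF this m] show "bounded_fun C (\<lambda>q. f (join S p q))"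
    using assms by (simp add: bounded_fun_def)
qed

sublocale MM: pair_prob_space M M ..

text \<open>Fubini's theorem for the split of the coordinates into \<open>S\<close> and its complement.\<close>

lemma integral_join:
  assumes f: "bounded_fun C f"
  shows "(\<integral>p. (\<integral>q. f (join S p q) \<partial>M) \<partial>M) = (\<integral>p. f p \<partial>M)"
proof -
  have m: "(\<lambda>x. f (join S (fst x) (snd x))) \<in> borel_measurable (M \<Otimes>\<^sub>M M)"
    using bounded_fun_join(2)[OF f] by (simp cong: measurable_cong_sets)
  have "integrable (M \<Otimes>\<^sub>M M) (\<lambda>x. f (join S (fst x) (snd x)))"
    by (rule MM.P.integrable_const_bound[where B = C]) (use f m in \<open>auto simp: bounded_fun_def\<close>)
  from MM.integral_fst'[OF this]
  have "(\<integral>p. (\<integral>q. f (join S p q) \<partial>M) \<partial>M) = (\<integral>x. f (join S (fst x) (snd x)) \<partial>(M \<Otimes>\<^sub>M M))"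
    by simp
  also have "\<dots> = (\<integral>p. f p \<partial>distr (M \<Otimes>\<^sub>M M) borel (\<lambda>x. join S (fst x) (snd x)))"
    by (rule integral_distr[symmetric])
      (use f join_measurable in \<open>auto simp: bounded_fun_def cong: measurable_cong_sets\<close>)
  finally show ?thesis by (simp add: distr_join)
qed

definition determined_by :: "int set \<Rightarrow> (point \<Rightarrow> 'b) \<Rightarrow> bool" where
  "determined_by J f \<longleftrightarrow> (\<forall>p q. (\<forall>i\<in>J. res i p = res i q) \<longrightarrow> f p = f q)"

definition local_fun :: "(point \<Rightarrow> complex) \<Rightarrow> bool" where
  "local_fun f \<longleftrightarrow> (\<exists>J. finite J \<and> determined_by J f)"

lemma determined_byD: "determined_by J f \<Longrightarrow> (\<And>i. i \<in> J \<Longrightarrow> res i p = res i q) \<Longrightarrow> f p = f q"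
  by (auto simp: determined_by_def)

lemma determined_by_comp: "determined_by J f \<Longrightarrow> determined_by J (\<lambda>p. h (f p))"
  unfolding determined_by_def by metis

lemma determined_by_comp2:
  "determined_by J f \<Longrightarrow> determined_by K g \<Longrightarrow> determined_by (J \<union> K) (\<lambda>p. h (f p) (g p))"
  unfolding determined_by_def by (metis UnCI)

lemma determined_by_res: "determined_by {i} (\<lambda>p. h (res i p))"
  unfolding determined_by_def by simp

lemma res_embed: "res i (embed u) = u i mod s i"
  by (simp add: res_def embed_def nat_mod_distrib)

lemma determined_by_embed:
  assumes "determined_by J f"
  shows "f p = f (embed (restrict (\<lambda>i. res i p) J))"
  by (rule determined_byD[OF assms]) (simp add: res_embed res_less)

lemma res_restrict_measurable:
  assumes "finite J"
  shows "(\<lambda>p. restrict (\<lambda>i. res i p) J) \<in> borel \<rightarrow>\<^sub>M count_space (PiE J (\<lambda>_. UNIV))"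
proof -
  have "(\<lambda>p. restrict (\<lambda>i. res i p) J) \<in> borel \<rightarrow>\<^sub>M PiM J (\<lambda>_. count_space UNIV)"
    by (rule measurable_restrict) measurable
  moreover have "PiM J (\<lambda>_. count_space UNIV :: nat measure) = count_space (PiE J (\<lambda>_. UNIV))"
    using assms by (intro count_space_PiM_finite) auto
  ultimately show ?thesis by simp
qed

text \<open>Only finitely many values of the coordinates in \<open>J\<close> matter, so any function of them is measurable.\<close>

lemma determined_by_measurable:
  fixes f :: "point \<Rightarrow> 'b"
  assumes "finite J" "determined_by J f" "space X = UNIV"
  shows "f \<in> borel \<rightarrow>\<^sub>M X"
proof -
  have "(\<lambda>v. f (embed v)) \<in> count_space (PiE J (\<lambda>_. UNIV)) \<rightarrow>\<^sub>M X" using assms by simp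
  from measurable_compose[OF res_restrict_measurable[OF \<open>finite J\<close>] this]
  show ?thesis by (subst measurable_cong[OF determined_by_embed[OF assms(2)]]) simp
qed

lemma determined_by_finite_range:
  assumes "finite J" "determined_by J f"
  shows "finite (range f)"
proof (rule finite_subset)
  show "range f \<subseteq> (\<lambda>v. f (embed v)) ` PiE J (\<lambda>i. {..<s i})"
  proof safe
    fix p
    have "restrict (\<lambda>i. res i p) J \<in> PiE J (\<lambda>i. {..<s i})" using res_less by auto
    then show "f p \<in> (\<lambda>v. f (embed v)) ` PiE J (\<lambda>i. {..<s i})"
      using determined_by_embed[OF assms(2), of p] by blast
  qed
  show "finite ((\<lambda>v. f (embed v)) ` PiE J (\<lambda>i. {..<s i}))"
    using assms(1) by (intro finite_imageI finite_PiE) auto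
qed

lemma local_fun_bounded:
  assumes "local_fun f" obtains C where "bounded_fun C f"
proof -
  obtain J where J: "finite J" "determined_by J f" using assms by (auto simp: local_fun_def)
  have "finite (cmod ` range f)" using determined_by_finite_range[OF J] by simp
  then have "\<forall>p. cmod (f p) \<le> Max (cmod ` range f)" by auto
  moreover have "f \<in> borel_measurable borel" by (rule determined_by_measurable[OF J]) simp
  ultimately show ?thesis using that by (auto simp: bounded_fun_def)
qed

lemma local_fun_measurable: "local_fun f \<Longrightarrow> f \<in> borel_measurable borel"
  using local_fun_bounded bounded_fun_measurable by metis

lemma local_fun_mult: "local_fun f \<Longrightarrow> local_fun g \<Longrightarrow> local_fun (\<lambda>p. f p * g p)"
  unfolding local_fun_def using determined_by_comp2[of _ f _ g "(*)"] finite_UnI by blast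

lemma local_fun_comp: "local_fun f \<Longrightarrow> local_fun (\<lambda>p. h (f p))"
  unfolding local_fun_def using determined_by_comp[of _ f h] by blast

text \<open>Joining at \<open>J\<close> separates the variables of the two factors.\<close>

lemma integral_mult_indep:
  assumes f: "bounded_fun C f" "determined_by J f" and g: "bounded_fun D g" "determined_by K g"
    and "J \<inter> K = {}"
  shows "(\<integral>p. f p * g p \<partial>M) = (\<integral>p. f p \<partial>M) * (\<integral>p. g p \<partial>M)"
proof -
  have "f (join J p q) = f p" "g (join J p q) = g q" for p q
    using assms(5) by (auto intro!: determined_byD[OF f(2)] determined_byD[OF g(2)] simp: res_join)
  then have "(\<integral>p. f p * g p \<partial>M) = (\<integral>p. (\<integral>q. f p * g q \<partial>M) \<partial>M)"
    using integral_join[OF bounded_fun_mult[OF f(1) g(1)], of J] by simp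
  then show ?thesis by simp
qed

lemma res_T_pow_odd: "odd i \<Longrightarrow> res i ((T ^^ n) p) = (res i p + n) mod s i"
proof (induction n)
  case 0 then show ?case using res_less[of i p] by simp
next
  case (Suc n) then show ?case by (simp add: res_T_odd mod_Suc_eq)
qed

lemma res_T_pow_even: "even i \<Longrightarrow> res i ((T ^^ n) p) = res (i + 2 * int n) p"
proof (induction n arbitrary: i)
  case (Suc n) then show ?case by (simp add: res_T_even algebra_simps)
qed simp

lemma determined_by_T_pow:
  assumes "determined_by J f"
  shows "determined_by ((\<lambda>i. if even i then i + 2 * int n else i) ` J) (\<lambda>p. f ((T ^^ n) p))"
  unfolding determined_by_def
proof (intro allI impI)
  fix p q assume *: "\<forall>i\<in>(\<lambda>i. if even i then i + 2 * int n else i) ` J. res i p = res i q"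
  show "f ((T ^^ n) p) = f ((T ^^ n) q)"
  proof (rule determined_byD[OF assms])
    fix i assume "i \<in> J"
    then show "res i ((T ^^ n) p) = res i ((T ^^ n) q)"
      using *[rule_format, OF imageI[OF \<open>i \<in> J\<close>]]
      by (cases "even i") (auto simp: res_T_pow_even res_T_pow_odd)
  qed
qed

lemma local_fun_T_pow: "local_fun f \<Longrightarrow> local_fun (\<lambda>p. f ((T ^^ n) p))"
  unfolding local_fun_def using determined_by_T_pow[of _ f n] finite_imageI by blast

text \<open>All rotations in \<open>J\<close> return to their starting points after the product of their orders.\<close>

lemma odd_period:
  assumes J: "\<And>i. i \<in> J \<Longrightarrow> odd i" "finite J" and f: "determined_by J f"
  shows "f ((T ^^ (n + (\<Prod>i\<in>J. s i))) p) = f ((T ^^ n) p)"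
proof (rule determined_byD[OF f])
  fix i assume "i \<in> J"
  then have "s i dvd (\<Prod>i\<in>J. s i)" using J(2) by (simp add: dvd_prodI)
  then obtain d where "(\<Prod>i\<in>J. s i) = s i * d" by (rule dvdE)
  then have "(res i p + (n + (\<Prod>i\<in>J. s i))) mod s i = (res i p + n) mod s i"
    by (simp add: add.assoc[symmetric])
  then show "res i ((T ^^ (n + (\<Prod>i\<in>J. s i))) p) = res i ((T ^^ n) p)"
    using J(1)[OF \<open>i \<in> J\<close>] by (simp add: res_T_pow_odd)
qed

text \<open>The product of the rotations in \<open>J\<close> is one cycle, by the Chinese remainder theorem. So the sum over a
full period is the same from every starting point, and it equals its integral.\<close>

lemma orbit_sum_odd:
  assumes J: "\<And>i. i \<in> J \<Longrightarrow> odd i" "finite J" and f: "determined_by J (f :: point \<Rightarrow> complex)"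
  defines "m \<equiv> \<Prod>i\<in>J. s i"
  shows "(\<Sum>n<m. f ((T ^^ n) p)) = of_nat m * (\<integral>p. f p \<partial>M)"
proof -
  define g where "g p = (\<Sum>n<m. f ((T ^^ n) p))" for p
  have per: "f ((T ^^ (n + m)) p) = f ((T ^^ n) p)" for n p
    unfolding m_def by (rule odd_period[OF J f])
  have const: "g q = g p" for q
  proof -
    have "\<forall>i\<in>J. \<forall>j\<in>J. i \<noteq> j \<longrightarrow> coprime (s i) (s j)" using s_coprime J(1) by blast
    from chinese_remainder_nat[OF J(2) this, of "\<lambda>i. res i q + (s i - res i p)"]
    obtain k where k: "\<forall>i\<in>J. [k = res i q + (s i - res i p)] (mod s i)" by blast
    have "g q = (\<Sum>n<m. f ((T ^^ n) ((T ^^ k) p)))"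
      unfolding g_def
    proof (intro sum.cong refl determined_byD[OF f])
      fix n i assume "i \<in> J"
      have "[res i p + k = res i p + (res i q + (s i - res i p))] (mod s i)"
        using k \<open>i \<in> J\<close> by (simp add: cong_add_lcancel_nat)
      also have "res i p + (res i q + (s i - res i p)) = res i q + s i"
        using res_less[of i p] by simp
      finally have "(res i p + k) mod s i = res i q"
        using res_less[of i q] by (simp add: cong_def)
      then show "res i ((T ^^ n) q) = res i ((T ^^ n) ((T ^^ k) p))"
        using J(1)[OF \<open>i \<in> J\<close>] by (simp add: res_T_pow_odd)
    qed
    also have "\<dots> = (\<Sum>n<m. f ((T ^^ (n + k)) p))" by (simp add: funpow_add)
    also have "\<dots> = g p" unfolding g_def by (rule sum_periodic_shift) (rule per)
    finally show ?thesis .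
  qed
  have "local_fun f" using J(2) f unfolding local_fun_def by blast
  then obtain C where C: "bounded_fun C f" by (rule local_fun_bounded)
  have "(\<integral>q. g q \<partial>M) = (\<integral>q. g p \<partial>M)"
    by (intro Bochner_Integration.integral_cong refl const)
  then have "g p = (\<integral>q. g q \<partial>M)" by (simp add: prob_space)
  also have "\<dots> = (\<Sum>n<m. (\<integral>q. f ((T ^^ n) q) \<partial>M))"
    unfolding g_def by (rule Bochner_Integration.integral_sum) (rule bounded_fun_integrable[OF bounded_fun_T_pow[OF C]])
  also have "\<dots> = of_nat m * (\<integral>p. f p \<partial>M)"
    by (simp add: integral_T_pow[OF bounded_fun_measurable[OF C]])
  finally show ?thesis unfolding g_def .
qed

section \<open>Averaging out the Bernoulli coordinates\<close>

abbreviation Odd :: "int set" where "Odd \<equiv> {i. odd i}"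

text \<open>The integral over the bits with fixed rotation coordinates: an explicit version of the conditional
expectation on the rotation coordinates that is defined at every point.\<close>

definition proj :: "(point \<Rightarrow> complex) \<Rightarrow> point \<Rightarrow> complex" where
  "proj f p = (\<integral>q. f (join Odd p q) \<partial>M)"

definition L1dist :: "(point \<Rightarrow> complex) \<Rightarrow> (point \<Rightarrow> complex) \<Rightarrow> real" where
  "L1dist f g = (\<integral>p. cmod (f p - g p) \<partial>M)"

lemma join_join [simp]: "join S (join S p q) r = join S p r"
  by (auto simp: join_def)

lemma join_T_pow: "join Odd ((T ^^ n) p) ((T ^^ n) q) = (T ^^ n) (join Odd p q)"
  by (induction n) (auto simp: join_T)

lemma cmod_integral_le: "bounded_fun C f \<Longrightarrow> cmod (\<integral>p. f p \<partial>M) \<le> C"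
proof -
  assume f: "bounded_fun C f"
  have "cmod (\<integral>p. f p \<partial>M) \<le> (\<integral>p. cmod (f p) \<partial>M)" by (rule integral_norm_bound)
  also have "\<dots> \<le> (\<integral>p. C \<partial>M)"
    using f bounded_fun_integrable[OF f] by (intro integral_mono) (auto simp: bounded_fun_def)
  finally show ?thesis by simp
qed

lemma bounded_fun_diff:
  "bounded_fun C f \<Longrightarrow> bounded_fun D g \<Longrightarrow> bounded_fun (C + D) (\<lambda>p. f p - g p)"
  unfolding bounded_fun_def by (auto intro: order_trans[OF norm_triangle_ineq4] add_mono)

lemma bounded_fun_cmod: "bounded_fun C f \<Longrightarrow> bounded_fun C (\<lambda>p. of_real (cmod (f p)))"
  unfolding bounded_fun_def by auto

lemma integrable_cmod_diff:
  "bounded_fun C f \<Longrightarrow> bounded_fun D g \<Longrightarrow> integrable M (\<lambda>p. cmod (f p - g p))"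
  by (intro integrable_norm bounded_fun_integrable[OF bounded_fun_diff])

lemma L1dist_nonneg [simp]: "0 \<le> L1dist f g"
  by (simp add: L1dist_def)

lemma cmod_integral_diff_le:
  assumes "bounded_fun C f" "bounded_fun D g"
  shows "cmod ((\<integral>p. f p \<partial>M) - (\<integral>p. g p \<partial>M)) \<le> L1dist f g"
proof -
  have "(\<integral>p. f p \<partial>M) - (\<integral>p. g p \<partial>M) = (\<integral>p. f p - g p \<partial>M)"
    using assms by (simp add: bounded_fun_integrable)
  then show ?thesis unfolding L1dist_def by (simp add: integral_norm_bound)
qed

lemma proj_bounded:
  assumes f: "bounded_fun C f" shows "bounded_fun C (proj f)"
  unfolding bounded_fun_def
proof (intro conjI allI)
  have "(\<lambda>(p, q). f (join Odd p q)) \<in> borel_measurable (borel \<Otimes>\<^sub>M M)"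
    using bounded_fun_join(2)[OF f] by (simp add: split_beta cong: measurable_cong_sets)
  from borel_measurable_lebesgue_integral[OF this]
  show "proj f \<in> borel_measurable borel" unfolding proj_def .
  show "cmod (proj f p) \<le> C" for p
    unfolding proj_def by (rule cmod_integral_le[OF bounded_fun_join(1)[OF f]])
qed

lemma proj_join: "proj f (join Odd p q) = proj f p"
  by (simp add: proj_def)

lemma integral_proj: "bounded_fun C f \<Longrightarrow> (\<integral>p. proj f p \<partial>M) = (\<integral>p. f p \<partial>M)"
  unfolding proj_def by (rule integral_join)

text \<open>The premise says that \<open>h\<close> depends only on the rotation coordinates.\<close>

lemma proj_mult_left:
  "(\<And>p q. h (join Odd p q) = h p) \<Longrightarrow> proj (\<lambda>p. h p * f p) p = h p * proj f p"
  by (simp add: proj_def)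

lemma proj_cnj: "proj (\<lambda>p. cnj (f p)) p = cnj (proj f p)"
  by (simp add: proj_def)

lemma proj_T_pow:
  assumes f: "bounded_fun C f"
  shows "proj (\<lambda>p. f ((T ^^ n) p)) p = proj f ((T ^^ n) p)"
  using integral_T_pow[OF bounded_fun_measurable[OF bounded_fun_join(1)[OF f, of Odd "(T ^^ n) p"]], of n]
  by (simp add: proj_def join_T_pow)

text \<open>The triangle inequality for the inner integral, followed by Fubini's theorem.\<close>

lemma L1dist_proj_le:
  assumes f: "bounded_fun C f" and g: "bounded_fun D g"
  shows "L1dist (proj f) (proj g) \<le> L1dist f g"
proof -
  let ?h = "\<lambda>p. complex_of_real (cmod (f p - g p))"
  have h: "bounded_fun (C + D) ?h" by (intro bounded_fun_cmod bounded_fun_diff f g)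
  have le: "cmod (proj f p - proj g p) \<le> (\<integral>q. cmod (f (join Odd p q) - g (join Odd p q)) \<partial>M)" for p
    using cmod_integral_diff_le[OF bounded_fun_join(1)[OF f] bounded_fun_join(1)[OF g], of Odd p Odd p]
    by (simp add: proj_def L1dist_def)
  have *: "proj ?h p = of_real (\<integral>q. cmod (f (join Odd p q) - g (join Odd p q)) \<partial>M)" for p
    by (simp add: proj_def)
  have "integrable M (\<lambda>p. Re (proj ?h p))"
    by (intro integrable_Re bounded_fun_integrable[OF proj_bounded[OF h]])
  then have int: "integrable M (\<lambda>p. (\<integral>q. cmod (f (join Odd p q) - g (join Odd p q)) \<partial>M))"
    by (simp add: *)
  have "L1dist (proj f) (proj g) \<le> (\<integral>p. (\<integral>q. cmod (f (join Odd p q) - g (join Odd p q)) \<partial>M) \<partial>M)"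
    unfolding L1dist_def
    by (intro integral_mono le int integrable_cmod_diff[OF proj_bounded[OF f] proj_bounded[OF g]])
  also have "\<dots> = Re (\<integral>p. proj ?h p \<partial>M)" by (simp add: *)
  also have "\<dots> = L1dist f g" by (subst integral_proj[OF h]) (simp add: L1dist_def)
  finally show ?thesis .
qed

lemma proj_determined_by:
  assumes "determined_by J f" shows "determined_by (J \<inter> Odd) (proj f)"
  unfolding determined_by_def
proof (intro allI impI)
  fix p q assume *: "\<forall>i\<in>J \<inter> Odd. res i p = res i q"
  have "f (join Odd p r) = f (join Odd q r)" for r
    by (rule determined_byD[OF assms]) (use * in \<open>simp add: res_join\<close>)
  then show "proj f p = proj f q" by (simp add: proj_def)
qed

lemma local_fun_proj_odd:
  assumes "local_fun f"
  obtains J where "finite J" "\<And>i. i \<in> J \<Longrightarrow> odd i" "determined_by J (proj f)"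
proof -
  obtain J where J: "finite J" "determined_by J f" using assms by (auto simp: local_fun_def)
  show ?thesis
    by (rule that[OF _ _ proj_determined_by[OF J(2)]]) (use J(1) in simp_all)
qed

text \<open>For fixed rotation coordinates, the two factors depend on bits in finite sets of indices, the second of
which moves by \<open>2n\<close>. Once these sets are disjoint, the factors are independent.\<close>

lemma proj_local_correlation:
  assumes f: "local_fun f" and g: "local_fun g"
  obtains n0 where "\<And>n p. n \<ge> n0 \<Longrightarrow> proj (\<lambda>p. f p * g ((T ^^ n) p)) p = proj f p * proj g ((T ^^ n) p)"
proof -
  obtain J where J: "finite J" "determined_by J f" using f by (auto simp: local_fun_def)
  obtain K where K: "finite K" "determined_by K g" using g by (auto simp: local_fun_def)
  obtain C where C: "bounded_fun C f" using local_fun_bounded[OF f] .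
  obtain D where D: "bounded_fun D g" using local_fun_bounded[OF g] .
  \<comment> \<open>All indices lie in \<open>[-B, B]\<close>, and the shift by \<open>2n\<close> must carry this interval off itself.\<close>
  define B where "B = Max (insert 0 (abs ` (J \<union> K)))"
  have B: "\<bar>i\<bar> \<le> B" if "i \<in> J \<union> K" for i using J(1) K(1) that by (auto simp: B_def)
  have "proj (\<lambda>p. f p * g ((T ^^ n) p)) p = proj f p * proj g ((T ^^ n) p)" if n: "n \<ge> nat B + 1" for n p
  proof -
    let ?K = "(\<lambda>i. if even i then i + 2 * int n else i) ` K"
    have "(J - Odd) \<inter> (?K - Odd) = {}"
    proof -
      have False if "i \<in> J" "j \<in> K" "even j" "i = j + 2 * int n" for i j
        using B[of i] B[of j] that n by auto
      then show ?thesis by (auto split: if_splits)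
    qed
    moreover have "determined_by (J - Odd) (\<lambda>q. f (join Odd p q))"
      unfolding determined_by_def[of "J - Odd"] by (auto intro!: determined_byD[OF J(2)] simp: res_join)
    moreover have "determined_by (?K - Odd) (\<lambda>q. g ((T ^^ n) (join Odd p q)))"
      unfolding determined_by_def[of "?K - Odd"]
      by (auto intro!: determined_byD[OF determined_by_T_pow[OF K(2), of n]] simp: res_join)
    ultimately have "proj (\<lambda>p. f p * g ((T ^^ n) p)) p = proj f p * proj (\<lambda>p. g ((T ^^ n) p)) p"
      unfolding proj_def
      by (intro integral_mult_indep[OF bounded_fun_join(1)[OF C] _ bounded_fun_join(1)[OF bounded_fun_T_pow[OF D]]])
    then show ?thesis by (simp add: proj_T_pow[OF D])
  qed
  then show ?thesis using that by blast
qed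

text \<open>Invariance under the replacement of all bits is a condition at every point, which makes the closure
properties of a \<open>\<sigma>\<close>-algebra and the invariance under \<open>T\<close> evident.\<close>

definition odd_events :: "point set set" where
  "odd_events = {A \<in> sets borel. \<forall>p q. join Odd p q \<in> A \<longleftrightarrow> p \<in> A}"

definition Z :: "point measure" where
  "Z = sigma UNIV odd_events"

lemma sigma_algebra_odd_events: "sigma_algebra UNIV odd_events"
  unfolding sigma_algebra_iff2 by (auto simp: odd_events_def)

lemma sets_Z [simp]: "sets Z = odd_events" and space_Z [simp]: "space Z = UNIV"
  unfolding Z_def using sigma_algebra.sigma_sets_eq[OF sigma_algebra_odd_events]
  by (auto simp: sets_measure_of_conv space_measure_of_conv)

lemma subalgebra_Z: "subalgebra M Z"
  by (auto simp: subalgebra_def odd_events_def)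

lemma Z_T_invariant: "(\<lambda>A. T -` A \<inter> space M) ` sets Z = sets Z"
proof -
  have pre: "T -` A \<in> odd_events" if "A \<in> odd_events" for A
    using that measurable_sets[OF T_measurable, of A]
    by (auto simp: odd_events_def join_T[symmetric])
  have pre_inv: "T_inv -` A \<in> odd_events" if "A \<in> odd_events" for A
  proof -
    have "T_inv (join Odd p q) = join Odd (T_inv p) (T_inv q)" for p q
      by (metis T_T_inv T_inv_T join_T)
    then show ?thesis
      using that measurable_sets[OF T_inv_measurable, of A] by (auto simp: odd_events_def)
  qed
  have "A \<in> (\<lambda>A. T -` A \<inter> space M) ` odd_events" if "A \<in> odd_events" for A
    by (rule image_eqI[OF _ pre_inv[OF that]]) (simp add: vimage_def)
  then show ?thesis using pre by auto
qed

lemma proj_Z_measurable: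
  assumes f: "bounded_fun C f" shows "proj f \<in> borel_measurable Z"
proof (rule measurableI)
  fix U :: "complex set" assume "U \<in> sets borel"
  then have "proj f -` U \<in> sets borel"
    using measurable_sets[OF bounded_fun_measurable[OF proj_bounded[OF f]], of U] by simp
  then show "proj f -` U \<inter> space Z \<in> sets Z" by (simp add: odd_events_def proj_join)
qed simp

text \<open>The defining property of conditional expectations, obtained by integrating \<open>proj\<close> of \<open>f\<close> times the
indicator of an event of \<open>Z\<close>.\<close>

lemma real_cond_exp_Re:
  assumes f: "bounded_fun C f"
  shows "AE p in M. real_cond_exp M Z (\<lambda>p. Re (f p)) p = Re (proj f p)"
proof -
  interpret finite_measure_subalgebra M Z
    by unfold_locales (rule subalgebra_Z)
  show ?thesis
  proof (rule real_cond_exp_charact)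
    show "integrable M (\<lambda>p. Re (f p))" "integrable M (\<lambda>p. Re (proj f p))"
      by (intro integrable_Re bounded_fun_integrable[OF f] bounded_fun_integrable[OF proj_bounded[OF f]])+
    show "(\<lambda>p. Re (proj f p)) \<in> borel_measurable Z"
      using proj_Z_measurable[OF f] by measurable
    fix A assume "A \<in> sets Z"
    then have A: "A \<in> sets borel" "\<And>p q. join Odd p q \<in> A \<longleftrightarrow> p \<in> A" by (auto simp: odd_events_def)
    let ?h = "\<lambda>p. complex_of_real (indicator A p)"
    have h: "bounded_fun 1 ?h" using A(1) unfolding bounded_fun_def by (auto simp: indicator_def)
    have "(\<integral>p. ?h p * f p \<partial>M) = (\<integral>p. proj (\<lambda>p. ?h p * f p) p \<partial>M)"
      by (rule integral_proj[OF bounded_fun_mult[OF h f], symmetric])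
    also have "\<dots> = (\<integral>p. ?h p * proj f p \<partial>M)"
      by (intro Bochner_Integration.integral_cong refl proj_mult_left) (simp add: A(2) indicator_def)
    finally have "Re (\<integral>p. ?h p * f p \<partial>M) = Re (\<integral>p. ?h p * proj f p \<partial>M)" by simp
    then have "(\<integral>p. Re (?h p * f p) \<partial>M) = (\<integral>p. Re (?h p * proj f p) \<partial>M)"
      by (simp only: integral_Re[OF bounded_fun_integrable[OF bounded_fun_mult[OF h f]]]
          integral_Re[OF bounded_fun_integrable[OF bounded_fun_mult[OF h proj_bounded[OF f]]]])
    then show "(\<integral>p\<in>A. Re (f p) \<partial>M) = (\<integral>p\<in>A. Re (proj f p) \<partial>M)"
      by (simp add: set_lebesgue_integral_def)
  qed
qed

text \<open>The imaginary part of \<open>f\<close> is the real part of \<open>- \<i> f\<close>.\<close>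

lemma complex_cond_exp_eq_proj:
  assumes f: "bounded_fun C f"
  shows "AE p in M. complex_cond_exp M Z f p = proj f p"
proof -
  have "bounded_fun (1 * C) (\<lambda>p. (- \<i>) * f p)"
    by (rule bounded_fun_mult[OF _ f]) (simp add: bounded_fun_def)
  from real_cond_exp_Re[OF this] have "AE p in M. real_cond_exp M Z (\<lambda>p. Im (f p)) p = Im (proj f p)"
    by (simp add: proj_def)
  with real_cond_exp_Re[OF f] show ?thesis
    by eventually_elim (simp add: complex_cond_exp_def complex_eq_iff)
qed

section \<open>Density of the local functions\<close>

definition local_event :: "point set \<Rightarrow> bool" where
  "local_event B \<longleftrightarrow> (\<exists>J. finite J \<and> determined_by J (\<lambda>p. p \<in> B))"

definition approximable_events :: "point set set" where
  "approximable_events =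
     {A \<in> sets borel. \<forall>\<epsilon>>0. \<exists>B. local_event B \<and> measure M (sym_diff A B) < \<epsilon>}"

lemma local_event_measurable: "local_event B \<Longrightarrow> B \<in> sets borel"
proof -
  assume "local_event B"
  then obtain J where J: "finite J" "determined_by J (\<lambda>p. p \<in> B)" by (auto simp: local_event_def)
  have "Measurable.pred borel (\<lambda>p. p \<in> B)" by (rule determined_by_measurable[OF J]) simp
  then show ?thesis using pred_sets2 by (simp add: pred_def)
qed

lemma local_event_Compl: "local_event B \<Longrightarrow> local_event (- B)"
  unfolding local_event_def using determined_by_comp[of _ "\<lambda>p. p \<in> B" Not] by auto

lemma local_event_Un:
  assumes "local_event B" "local_event B'" shows "local_event (B \<union> B')"
proof -
  obtain J where J: "finite J" "determined_by J (\<lambda>p. p \<in> B)" using assms(1) by (auto simp: local_event_def)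
  obtain K where K: "finite K" "determined_by K (\<lambda>p. p \<in> B')" using assms(2) by (auto simp: local_event_def)
  show ?thesis
    unfolding local_event_def
    by (rule exI[of _ "J \<union> K"])
      (use determined_by_comp2[OF J(2) K(2), of "(\<or>)"] J(1) K(1) in simp)
qed

lemma local_event_empty: "local_event {}"
  unfolding local_event_def by (rule exI[of _ "{}"]) (simp add: determined_by_def)

lemma local_event_UN:
  "(\<And>i. i < n \<Longrightarrow> local_event (B i)) \<Longrightarrow> local_event (\<Union>i<n::nat. B i)"
  by (induction n) (auto simp: lessThan_Suc local_event_empty local_event_Un)

lemma approximable_eventsI:
  assumes A: "A \<in> sets borel" and B: "local_event B" and eq: "AE p in M. p \<in> A \<longleftrightarrow> p \<in> B"
  shows "A \<in> approximable_events"
proof -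
  have "AE p in M. p \<notin> sym_diff A B" using eq by eventually_elim blast
  then have "measure M (sym_diff A B) = 0"
    using A local_event_measurable[OF B] by (subst prob_eq_0) auto
  then show ?thesis using A B by (auto simp: approximable_events_def)
qed

text \<open>A countable union is approximated by a finite one, and a finite union by the union of approximations
of its members.\<close>

lemma approximable_events_sigma_algebra: "sigma_algebra UNIV approximable_events"
  unfolding sigma_algebra_iff2
proof (intro conjI ballI allI impI)
  show "approximable_events \<subseteq> Pow UNIV" by simp
  show "{} \<in> approximable_events"
    by (rule approximable_eventsI[OF _ local_event_empty]) auto
next
  fix A assume A: "A \<in> approximable_events"
  have "\<exists>B. local_event B \<and> measure M (sym_diff (- A) B) < \<epsilon>" if "\<epsilon> > 0" for \<epsilon>
  proof -
    obtain B where B: "local_event B" "measure M (sym_diff A B) < \<epsilon>"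
      using A \<open>\<epsilon> > 0\<close> unfolding approximable_events_def by blast
    moreover have "sym_diff (- A) (- B) = sym_diff A B" by auto
    ultimately show ?thesis using local_event_Compl by metis
  qed
  then show "UNIV - A \<in> approximable_events"
    using A by (auto simp: approximable_events_def Compl_eq_Diff_UNIV)
next
  fix A :: "nat \<Rightarrow> point set" assume A: "range A \<subseteq> approximable_events"
  have [measurable]: "A i \<in> sets borel" for i using A by (auto simp: approximable_events_def)
  have "\<exists>B. local_event B \<and> measure M (sym_diff (\<Union>i. A i) B) < \<epsilon>" if \<epsilon>: "\<epsilon> > 0" for \<epsilon>
  proof -
    have "(\<lambda>n. measure M (\<Union>i<n. A i)) \<longlonglongrightarrow> measure M (\<Union>n. \<Union>i<n. A i)"
      by (rule finite_Lim_measure_incseq) (auto simp: incseq_def, meson lessThan_iff order_less_le_trans)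
    moreover have "(\<Union>n. \<Union>i<n. A i) = (\<Union>i. A i)" by auto
    ultimately have "(\<lambda>n. measure M (\<Union>i<n. A i)) \<longlonglongrightarrow> measure M (\<Union>i. A i)" by simp
    from LIMSEQ_D[OF this, of "\<epsilon> / 2"] obtain n where
      n: "\<bar>measure M (\<Union>i<n. A i) - measure M (\<Union>i. A i)\<bar> < \<epsilon> / 2" using \<epsilon> by auto
    have "A i \<in> approximable_events" "\<epsilon> / (2 * real n + 2) > 0" for i using A \<epsilon> by auto
    then have "\<forall>i. \<exists>B. local_event B \<and> measure M (sym_diff (A i) B) < \<epsilon> / (2 * real n + 2)"
      unfolding approximable_events_def by blast
    then obtain B where B: "\<And>i. local_event (B i)"
      "\<And>i. measure M (sym_diff (A i) (B i)) < \<epsilon> / (2 * real n + 2)" by metis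
    have [measurable]: "B i \<in> sets borel" for i by (rule local_event_measurable[OF B(1)])
    have "measure M (sym_diff (\<Union>i. A i) (\<Union>i<n. B i))
        \<le> measure M (((\<Union>i. A i) - (\<Union>i<n. A i)) \<union> (\<Union>i<n. sym_diff (A i) (B i)))"
      by (intro finite_measure_mono) auto
    also have "\<dots> \<le> measure M ((\<Union>i. A i) - (\<Union>i<n. A i)) + measure M (\<Union>i<n. sym_diff (A i) (B i))"
      by (intro measure_Un_le) auto
    also have "measure M ((\<Union>i. A i) - (\<Union>i<n. A i)) = measure M (\<Union>i. A i) - measure M (\<Union>i<n. A i)"
      by (intro finite_measure_Diff) auto
    also have "\<dots> < \<epsilon> / 2" using n by linarith
    also have "measure M (\<Union>i<n. sym_diff (A i) (B i)) \<le> (\<Sum>i<n. measure M (sym_diff (A i) (B i)))"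
      by (intro measure_UNION_le) auto
    also have "\<dots> \<le> (\<Sum>i<n. \<epsilon> / (2 * real n + 2))"
      using B(2) by (intro sum_mono less_imp_le)
    also have "\<dots> \<le> \<epsilon> / 2" using \<epsilon> by (simp add: field_simps)
    finally show ?thesis using local_event_UN[of n B] B(1) by auto
  qed
  then show "\<Union> (range A) \<in> approximable_events" by (auto simp: approximable_events_def)
qed

text \<open>The coordinate maps are measurable with respect to the \<open>\<sigma>\<close>-algebra of approximable events, because every
coordinate almost surely equals its residue; hence so is the identity.\<close>

lemma approximable_events_eq: "approximable_events = sets borel"
proof
  show "approximable_events \<subseteq> sets borel" by (auto simp: approximable_events_def)
  define X where "X = sigma UNIV approximable_events"
  have X [simp]: "sets X = approximable_events" "space X = UNIV"
    unfolding X_def using sigma_algebra.sigma_sets_eq[OF approximable_events_sigma_algebra]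
    by (auto simp: sets_measure_of_conv space_measure_of_conv)
  have fst: "fst \<in> borel_measurable X"
  proof (rule measurableI)
    fix U :: "real set" assume U: "U \<in> sets borel"
    have "local_event (if 0 \<in> U then UNIV else {})"
      using local_event_empty local_event_Compl[OF local_event_empty] by auto
    moreover have "AE p in M. p \<in> fst -` U \<longleftrightarrow> p \<in> (if 0 \<in> U then UNIV else {})"
      using AE_fst by eventually_elim auto
    ultimately have "fst -` U \<in> approximable_events"
      using measurable_sets[OF fst_point_measurable U] by (intro approximable_eventsI) auto
    then show "fst -` U \<inter> space X \<in> sets X" by simp
  qed simp
  have snd: "(\<lambda>p. snd p i) \<in> borel_measurable X" for i
  proof (rule measurableI)
    fix U :: "real set" assume U: "U \<in> sets borel"
    have "local_event {p. real (res i p) \<in> U}"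
      unfolding local_event_def
      by (rule exI[of _ "{i}"]) (simp add: determined_by_res[where h = "\<lambda>k. real k \<in> U"])
    moreover have "AE p in M. p \<in> (\<lambda>p. snd p i) -` U \<longleftrightarrow> p \<in> {p. real (res i p) \<in> U}"
      using AE_coordinate[of i] by eventually_elim auto
    ultimately have "(\<lambda>p. snd p i) -` U \<in> approximable_events"
      using measurable_sets[OF coordinate_measurable U, of i] by (intro approximable_eventsI) auto
    then show "(\<lambda>p. snd p i) -` U \<inter> space X \<in> sets X" by simp
  qed simp
  have "(\<lambda>p. (fst p, \<lambda>i. snd p i)) \<in> borel_measurable X"
    by (intro borel_measurable_Pair measurable_coordinatewise_then_product fst snd)
  then have "(\<lambda>p. p) \<in> borel_measurable X" by simp
  from measurable_sets[OF this] show "sets borel \<subseteq> approximable_events" by auto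
qed

definition L1_approximable :: "(point \<Rightarrow> complex) \<Rightarrow> bool" where
  "L1_approximable f \<longleftrightarrow> (\<forall>\<epsilon>>0. \<exists>g. local_fun g \<and> L1dist f g < \<epsilon>)"

lemma local_fun_integrable: "local_fun g \<Longrightarrow> integrable M g"
  using local_fun_bounded bounded_fun_integrable by metis

lemma L1dist_triangle:
  assumes "integrable M f" "integrable M g" "integrable M h"
  shows "L1dist f h \<le> L1dist f g + L1dist g h"
proof -
  have "L1dist f h \<le> (\<integral>p. cmod (f p - g p) + cmod (g p - h p) \<partial>M)"
    unfolding L1dist_def using assms
    by (intro integral_mono integrable_norm Bochner_Integration.integrable_add Bochner_Integration.integrable_diff)
      (auto intro: norm_diff_triangle_ineq[of "f p" "g p" "g p" "h p" for p, simplified])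
  also have "\<dots> = L1dist f g + L1dist g h"
    unfolding L1dist_def using assms
    by (intro Bochner_Integration.integral_add integrable_norm Bochner_Integration.integrable_diff)
  finally show ?thesis .
qed

lemma integrable_L1_approximable:
  assumes "integrable M f" shows "L1_approximable f"
  using assms
proof (induction rule: integrable_induct)
  case (base A c)
  show ?case
    unfolding L1_approximable_def
  proof (intro allI impI)
    fix \<epsilon> :: real assume \<epsilon>: "\<epsilon> > 0"
    have "A \<in> approximable_events" using base approximable_events_eq by simp
    moreover have "\<epsilon> / (cmod c + 1) > 0" using \<epsilon> by (simp add: add_nonneg_pos)
    ultimately obtain B where B: "local_event B" "measure M (sym_diff A B) < \<epsilon> / (cmod c + 1)"
      unfolding approximable_events_def by blast
    let ?g = "\<lambda>p. if p \<in> B then c else 0"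
    have g: "local_fun ?g"
      using B(1) determined_by_comp[of _ "\<lambda>p. p \<in> B" "\<lambda>b. if b then c else 0"]
      unfolding local_fun_def local_event_def by blast
    have "L1dist (\<lambda>x. indicator A x *\<^sub>R c) ?g = (\<integral>p. cmod c * indicator (sym_diff A B) p \<partial>M)"
      unfolding L1dist_def by (intro Bochner_Integration.integral_cong) (auto simp: indicator_def)
    also have "\<dots> = cmod c * measure M (sym_diff A B)" by simp
    also have "\<dots> \<le> cmod c * (\<epsilon> / (cmod c + 1))" using B(2) by (intro mult_left_mono) auto
    also have "\<dots> < \<epsilon>" using \<epsilon> by (simp add: field_simps add_pos_nonneg)
    finally show "\<exists>g. local_fun g \<and> L1dist (\<lambda>x. indicator A x *\<^sub>R c) g < \<epsilon>" using g by blast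
  qed
next
  case (add f1 f2)
  show ?case
    unfolding L1_approximable_def
  proof (intro allI impI)
    fix \<epsilon> :: real assume \<epsilon>: "\<epsilon> > 0"
    obtain g1 where g1: "local_fun g1" "L1dist f1 g1 < \<epsilon> / 2"
      using add.IH(1) \<epsilon> unfolding L1_approximable_def by (meson half_gt_zero)
    obtain g2 where g2: "local_fun g2" "L1dist f2 g2 < \<epsilon> / 2"
      using add.IH(2) \<epsilon> unfolding L1_approximable_def by (meson half_gt_zero)
    let ?g = "\<lambda>p. g1 p + g2 p"
    have g: "local_fun ?g"
      using g1(1) g2(1) unfolding local_fun_def
      using determined_by_comp2[of _ g1 _ g2 "(+)"] finite_UnI by blast
    have int: "integrable M (\<lambda>p. f1 p - g1 p)" "integrable M (\<lambda>p. f2 p - g2 p)"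
      by (intro Bochner_Integration.integrable_diff add.hyps local_fun_integrable g1(1) g2(1))+
    have "L1dist (\<lambda>p. f1 p + f2 p) ?g \<le> (\<integral>p. cmod (f1 p - g1 p) + cmod (f2 p - g2 p) \<partial>M)"
      unfolding L1dist_def
    proof (rule integral_mono)
      show "integrable M (\<lambda>p. cmod (f1 p + f2 p - (g1 p + g2 p)))"
        using Bochner_Integration.integrable_add[OF int] by (intro integrable_norm) (simp add: algebra_simps)
      show "cmod (f1 p + f2 p - (g1 p + g2 p)) \<le> cmod (f1 p - g1 p) + cmod (f2 p - g2 p)" for p
        by (rule norm_diff_triangle_ineq)
    qed (use int in auto)
    also have "\<dots> = L1dist f1 g1 + L1dist f2 g2" unfolding L1dist_def using int by simp
    finally show "\<exists>g. local_fun g \<and> L1dist (\<lambda>p. f1 p + f2 p) g < \<epsilon>"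
      using g g1(2) g2(2) by (intro exI[of _ ?g]) auto
  qed
next
  case (lim f s)
  have [measurable]: "f \<in> borel_measurable M" "\<And>i. s i \<in> borel_measurable M"
    using lim.hyps by auto
  have "(\<lambda>i. \<integral>p. cmod (f p - s i p) \<partial>M) \<longlonglongrightarrow> (\<integral>p. 0 \<partial>M)"
  proof (rule integral_dominated_convergence[where w = "\<lambda>p. 3 * cmod (f p)"])
    show "integrable M (\<lambda>p. 3 * cmod (f p))" using lim.hyps by auto
    show "AE p in M. (\<lambda>i. cmod (f p - s i p)) \<longlonglongrightarrow> 0"
      using lim.hyps by (intro AE_I2) (auto intro!: tendsto_norm_zero tendsto_eq_intros)
    show "AE p in M. norm (cmod (f p - s i p)) \<le> 3 * cmod (f p)" for i
      using lim.hyps(3) by (intro AE_I2) (auto intro!: order_trans[OF norm_triangle_ineq4] simp: add.commute)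
  qed auto
  then have lim0: "(\<lambda>i. L1dist f (s i)) \<longlonglongrightarrow> 0" by (simp add: L1dist_def)
  show ?case
    unfolding L1_approximable_def
  proof (intro allI impI)
    fix \<epsilon> :: real assume \<epsilon>: "\<epsilon> > 0"
    from LIMSEQ_D[OF lim0, of "\<epsilon> / 2"] \<epsilon> obtain i where i: "L1dist f (s i) < \<epsilon> / 2" by auto
    obtain g where g: "local_fun g" "L1dist (s i) g < \<epsilon> / 2"
      using lim.IH[of i] \<epsilon> unfolding L1_approximable_def by (meson half_gt_zero)
    have "L1dist f g \<le> L1dist f (s i) + L1dist (s i) g"
      using lim.hyps local_fun_integrable[OF g(1)] by (intro L1dist_triangle) auto
    then show "\<exists>g. local_fun g \<and> L1dist f g < \<epsilon>" using i g by (intro exI[of _ g]) auto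
  qed
qed

text \<open>A local approximation is made to obey the bound of \<open>f\<close> by composing it with the nearest point
projection onto a disc. This does not increase the distance to \<open>f\<close> and keeps the function local.\<close>

lemma local_dense:
  assumes f: "bounded_fun C f" and \<epsilon>: "\<epsilon> > 0"
  obtains g where "local_fun g" "bounded_fun C g" "L1dist f g < \<epsilon>"
proof -
  obtain g where g: "local_fun g" "L1dist f g < \<epsilon>"
    using integrable_L1_approximable[OF bounded_fun_integrable[OF f]] \<epsilon>
    unfolding L1_approximable_def by blast
  let ?c = "closest_point (cball (0::complex) C)"
  have C: "cball (0::complex) C \<noteq> {}" "closed (cball (0::complex) C)" "convex (cball (0::complex) C)"
    using bounded_fun_nonneg[OF f] by auto
  have loc: "local_fun (\<lambda>p. ?c (g p))" by (rule local_fun_comp[OF g(1)])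
  have "?c z \<in> cball 0 C" for z by (rule closest_point_in_set) (use C in auto)
  then have bd: "bounded_fun C (\<lambda>p. ?c (g p))"
    using local_fun_measurable[OF loc] by (simp add: bounded_fun_def)
  obtain D where D: "bounded_fun D g" using local_fun_bounded[OF g(1)] .
  have "cmod (f p - ?c (g p)) \<le> cmod (f p - g p)" for p
  proof -
    have "?c (f p) = f p" by (rule closest_point_self) (use f in \<open>simp add: bounded_fun_def\<close>)
    then show ?thesis
      using closest_point_lipschitz[OF C(3,2,1), of "f p" "g p"] by (simp add: dist_norm)
  qed
  then have "L1dist f (\<lambda>p. ?c (g p)) \<le> L1dist f g"
    unfolding L1dist_def
    by (intro integral_mono integrable_cmod_diff[OF f bd] integrable_cmod_diff[OF f D])
  then show ?thesis using that[OF loc bd] g(2) by simp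
qed

section \<open>Iterated averages and the Host--Kra seminorms\<close>

text \<open>The multiplicative derivative, over which the next seminorm averages.\<close>

definition mderiv :: "nat \<Rightarrow> (point \<Rightarrow> complex) \<Rightarrow> point \<Rightarrow> complex" where
  "mderiv n f p = cnj (f p) * f ((T ^^ n) p)"

text \<open>The power \<open>2\<^sup>k\<^sup>+\<^sup>1\<close> of the seminorm of order \<open>k + 1\<close>. Unlike the seminorms, the powers are
Lipschitz in \<open>L\<^sup>1\<close> on uniformly bounded functions, and their recursion has no roots.\<close>

fun hk :: "nat \<Rightarrow> (point \<Rightarrow> complex) \<Rightarrow> real" where
  "hk 0 f = (cmod (\<integral>p. f p \<partial>M))\<^sup>2"
| "hk (Suc k) f = lim (cesaro (\<lambda>n. hk k (mderiv n f)))"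

text \<open>A Lipschitz constant of \<open>hk k\<close> in \<open>L\<^sup>1\<close> on the functions bounded by \<open>C\<close>.\<close>

fun lip :: "nat \<Rightarrow> real \<Rightarrow> real" where
  "lip 0 C = 2 * C"
| "lip (Suc k) C = lip k (C * C) * (2 * C)"

lemma lip_nonneg: "C \<ge> 0 \<Longrightarrow> lip k C \<ge> 0"
  by (induction k arbitrary: C) auto

lemma mderiv_bounded: "bounded_fun C f \<Longrightarrow> bounded_fun (C * C) (mderiv n f)"
  unfolding mderiv_def by (intro bounded_fun_mult bounded_fun_cnj bounded_fun_T_pow)

lemma mderiv_local: "local_fun f \<Longrightarrow> local_fun (mderiv n f)"
  unfolding mderiv_def by (intro local_fun_mult local_fun_comp[where h = cnj] local_fun_T_pow)

lemma L1dist_T_pow: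
  assumes "bounded_fun C f" "bounded_fun D g"
  shows "(\<integral>p. cmod (f ((T ^^ n) p) - g ((T ^^ n) p)) \<partial>M) = L1dist f g"
  unfolding L1dist_def
  using bounded_fun_measurable[OF assms(1)] bounded_fun_measurable[OF assms(2)]
  by (intro integral_T_pow[where f = "\<lambda>p. cmod (f p - g p)"]) measurable

lemma L1dist_mult_T_pow:
  assumes f: "bounded_fun C f" and f': "bounded_fun C f'" and g: "bounded_fun C g" and g': "bounded_fun C g'"
  shows "L1dist (\<lambda>p. f p * g ((T ^^ n) p)) (\<lambda>p. f' p * g' ((T ^^ n) p)) \<le> C * (L1dist f f' + L1dist g g')"
proof -
  have C: "C \<ge> 0" by (rule bounded_fun_nonneg[OF f])
  note gT = bounded_fun_T_pow[OF g, of n] and gT' = bounded_fun_T_pow[OF g', of n]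
  have "L1dist (\<lambda>p. f p * g ((T ^^ n) p)) (\<lambda>p. f' p * g' ((T ^^ n) p))
     \<le> (\<integral>p. C * cmod (f p - f' p) + C * cmod (g ((T ^^ n) p) - g' ((T ^^ n) p)) \<partial>M)"
    unfolding L1dist_def
  proof (rule integral_mono)
    show "integrable M (\<lambda>p. cmod (f p * g ((T ^^ n) p) - f' p * g' ((T ^^ n) p)))"
      by (rule integrable_cmod_diff[OF bounded_fun_mult[OF f gT] bounded_fun_mult[OF f' gT']])
    show "integrable M (\<lambda>p. C * cmod (f p - f' p) + C * cmod (g ((T ^^ n) p) - g' ((T ^^ n) p)))"
      using integrable_cmod_diff[OF f f'] integrable_cmod_diff[OF gT gT'] by auto
    fix p
    let ?x = "g ((T ^^ n) p)" and ?y = "g' ((T ^^ n) p)"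
    have "f p * ?x - f' p * ?y = ?x * (f p - f' p) + f' p * (?x - ?y)" by (simp add: algebra_simps)
    also have "cmod \<dots> \<le> cmod ?x * cmod (f p - f' p) + cmod (f' p) * cmod (?x - ?y)"
      by (intro order_trans[OF norm_triangle_ineq]) (simp add: norm_mult)
    also have "\<dots> \<le> C * cmod (f p - f' p) + C * cmod (?x - ?y)"
      using g f' by (intro add_mono mult_right_mono) (auto simp: bounded_fun_def)
    finally show "cmod (f p * ?x - f' p * ?y) \<le> C * cmod (f p - f' p) + C * cmod (?x - ?y)" .
  qed
  also have "\<dots> = C * L1dist f f' + C * L1dist g g'"
    unfolding L1dist_T_pow[OF g g', of n, symmetric] L1dist_def[of f f']
    using integrable_cmod_diff[OF f f'] integrable_cmod_diff[OF gT gT'] by simp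
  finally show ?thesis by (simp add: algebra_simps)
qed

lemma L1dist_cnj: "L1dist (\<lambda>p. cnj (f p)) (\<lambda>p. cnj (g p)) = L1dist f g"
  by (simp add: L1dist_def complex_cnj_diff[symmetric] del: complex_cnj_diff)

lemma L1dist_mderiv:
  assumes "bounded_fun C f" "bounded_fun C g"
  shows "L1dist (mderiv n f) (mderiv n g) \<le> 2 * C * L1dist f g"
  using L1dist_mult_T_pow[OF bounded_fun_cnj[OF assms(1)] bounded_fun_cnj[OF assms(2)] assms, of n]
  by (simp add: mderiv_def[abs_def] L1dist_cnj)

text \<open>Asymptotic independence of the bits: eventually, \<open>proj\<close> commutes with multiplicative derivatives.\<close>

lemma proj_mderiv:
  assumes "local_fun f"
  obtains n0 where "\<And>n. n \<ge> n0 \<Longrightarrow> proj (mderiv n f) = mderiv n (proj f)"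
proof -
  have "local_fun (\<lambda>p. cnj (f p))" using assms by (rule local_fun_comp)
  from proj_local_correlation[OF this assms] obtain n0 where
    "\<And>n p. n \<ge> n0 \<Longrightarrow> proj (\<lambda>p. cnj (f p) * f ((T ^^ n) p)) p = proj (\<lambda>p. cnj (f p)) p * proj f ((T ^^ n) p)"
    by blast
  then have "\<And>n. n \<ge> n0 \<Longrightarrow> proj (mderiv n f) = mderiv n (proj f)"
    by (simp add: fun_eq_iff mderiv_def[abs_def] proj_cnj)
  then show ?thesis by (rule that)
qed

lemma mderiv_proj_periodic:
  assumes "local_fun f"
  obtains m where "m > 0" "\<And>n. mderiv (n + m) (proj f) = mderiv n (proj f)"
proof -
  obtain J where J: "finite J" "\<And>i. i \<in> J \<Longrightarrow> odd i" "determined_by J (proj f)"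
    using local_fun_proj_odd[OF assms] by blast
  show ?thesis
  proof (rule that)
    show "(\<Prod>i\<in>J. s i) > 0" by (simp add: prod_pos s_pos)
    show "mderiv (n + (\<Prod>i\<in>J. s i)) (proj f) = mderiv n (proj f)" for n
      using odd_period[OF J(2,1,3), of n] by (simp add: mderiv_def fun_eq_iff)
  qed
qed

text \<open>The Lipschitz bound and the invariance under \<open>proj\<close> feed each other: both at order \<open>k\<close> are needed for the
limits of order \<open>k + 1\<close> to exist, and these limits inherit them.\<close>

definition hk_regular :: "nat \<Rightarrow> bool" where
  "hk_regular k \<longleftrightarrow>
     (\<forall>C f g. bounded_fun C f \<longrightarrow> bounded_fun C g \<longrightarrow> \<bar>hk k f - hk k g\<bar> \<le> lip k C * L1dist f g) \<and>
     (\<forall>f. local_fun f \<longrightarrow> hk k f = hk k (proj f))"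

text \<open>By the invariance of \<open>hk k\<close> under \<open>proj\<close>, the averaged sequence eventually coincides with the one of
\<open>proj f\<close>, and the latter is periodic.\<close>

lemma cesaro_hk_local:
  assumes k: "hk_regular k" and f: "local_fun f"
  obtains L where "cesaro (\<lambda>n. hk k (mderiv n f)) \<longlonglongrightarrow> L"
    "cesaro (\<lambda>n. hk k (mderiv n (proj f))) \<longlonglongrightarrow> L"
proof -
  obtain n0 where n0: "\<And>n. n \<ge> n0 \<Longrightarrow> proj (mderiv n f) = mderiv n (proj f)"
    using proj_mderiv[OF f] by blast
  obtain m where m: "m > 0" "\<And>n. mderiv (n + m) (proj f) = mderiv n (proj f)"
    using mderiv_proj_periodic[OF f] by blast
  have c: "cesaro (\<lambda>n. hk k (mderiv n (proj f))) \<longlonglongrightarrow> (\<Sum>n<m. hk k (mderiv n (proj f))) / of_nat m"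
    by (rule cesaro_periodic) (simp_all add: m)
  have "hk k (mderiv n f) = hk k (mderiv n (proj f))" if "n \<ge> n0" for n
    using k mderiv_local[OF f, of n] n0[OF that] by (simp add: hk_regular_def)
  from cesaro_eventually_eq[OF this c] show ?thesis using c by (rule that)
qed

lemma cesaro_hk_close:
  assumes k: "hk_regular k" and f: "bounded_fun C f" and g: "bounded_fun C g"
  shows "\<bar>cesaro (\<lambda>n. hk k (mderiv n f)) N - cesaro (\<lambda>n. hk k (mderiv n g)) N\<bar> \<le> lip (Suc k) C * L1dist f g"
proof -
  have C: "C \<ge> 0" by (rule bounded_fun_nonneg[OF f])
  have "\<bar>hk k (mderiv n f) - hk k (mderiv n g)\<bar> \<le> lip (Suc k) C * L1dist f g" for n
  proof -
    have "\<bar>hk k (mderiv n f) - hk k (mderiv n g)\<bar> \<le> lip k (C * C) * L1dist (mderiv n f) (mderiv n g)"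
      using k mderiv_bounded[OF f] mderiv_bounded[OF g] by (simp add: hk_regular_def)
    also have "\<dots> \<le> lip k (C * C) * (2 * C * L1dist f g)"
      using C by (intro mult_left_mono L1dist_mderiv f g lip_nonneg) auto
    finally show ?thesis by simp
  qed
  from cesaro_norm_diff_le[of "\<lambda>n. hk k (mderiv n f)", unfolded real_norm_def, OF this]
  show ?thesis .
qed

lemma cesaro_hk_convergent:
  assumes k: "hk_regular k" and f: "bounded_fun C f"
  shows "convergent (cesaro (\<lambda>n. hk k (mderiv n f)))"
proof (rule convergent_by_approximation)
  fix \<epsilon> :: real assume \<epsilon>: "\<epsilon> > 0"
  let ?l = "lip (Suc k) C"
  have l: "?l \<ge> 0" by (rule lip_nonneg[OF bounded_fun_nonneg[OF f]])
  have "\<epsilon> / (?l + 1) > 0" using \<epsilon> l by (intro divide_pos_pos) linarith+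
  from local_dense[OF f this]
  obtain g where g: "local_fun g" "bounded_fun C g" "L1dist f g < \<epsilon> / (?l + 1)" .
  obtain L where "cesaro (\<lambda>n. hk k (mderiv n g)) \<longlonglongrightarrow> L" using cesaro_hk_local[OF k g(1)] .
  then have "convergent (cesaro (\<lambda>n. hk k (mderiv n g)))" by (rule convergentI)
  moreover have "norm (cesaro (\<lambda>n. hk k (mderiv n f)) N - cesaro (\<lambda>n. hk k (mderiv n g)) N) \<le> \<epsilon>" for N
  proof -
    have "norm (cesaro (\<lambda>n. hk k (mderiv n f)) N - cesaro (\<lambda>n. hk k (mderiv n g)) N) \<le> ?l * L1dist f g"
      unfolding real_norm_def by (rule cesaro_hk_close[OF k f g(2)])
    also have "\<dots> \<le> ?l * (\<epsilon> / (?l + 1))" using l g(3) by (intro mult_left_mono) auto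
    also have "\<dots> \<le> \<epsilon>" using l \<epsilon> by (intro mult_divide_add1_le) auto
    finally show ?thesis .
  qed
  ultimately show "\<exists>Y. convergent Y \<and> (\<forall>N. norm (cesaro (\<lambda>n. hk k (mderiv n f)) N - Y N) \<le> \<epsilon>)"
    by blast
qed

lemma hk_regular: "hk_regular k"
proof (induction k)
  case 0
  show ?case
    unfolding hk_regular_def
  proof (intro conjI allI impI)
    fix C f g assume f: "bounded_fun C f" and g: "bounded_fun C g"
    let ?a = "cmod (\<integral>p. f p \<partial>M)" and ?b = "cmod (\<integral>p. g p \<partial>M)"
    have "\<bar>hk 0 f - hk 0 g\<bar> = \<bar>?a - ?b\<bar> * (?a + ?b)"
      by (simp add: power2_eq_square square_diff_square_factored abs_mult mult.commute)
    also have "\<dots> \<le> L1dist f g * (C + C)"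
      using cmod_integral_le[OF f] cmod_integral_le[OF g] cmod_integral_diff_le[OF f g]
        norm_triangle_ineq3[of "\<integral>p. f p \<partial>M" "\<integral>p. g p \<partial>M"]
      by (intro mult_mono add_mono) auto
    finally show "\<bar>hk 0 f - hk 0 g\<bar> \<le> lip 0 C * L1dist f g" by (simp add: algebra_simps)
  next
    fix f assume "local_fun f"
    then obtain C where "bounded_fun C f" by (rule local_fun_bounded)
    then show "hk 0 f = hk 0 (proj f)" by (simp add: integral_proj)
  qed
next
  case (Suc k)
  show ?case
    unfolding hk_regular_def
  proof (intro conjI allI impI)
    fix C f g assume f: "bounded_fun C f" and g: "bounded_fun C g"
    have "(\<lambda>N. \<bar>cesaro (\<lambda>n. hk k (mderiv n f)) N - cesaro (\<lambda>n. hk k (mderiv n g)) N\<bar>)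
        \<longlonglongrightarrow> \<bar>hk (Suc k) f - hk (Suc k) g\<bar>"
      using cesaro_hk_convergent[OF Suc f] cesaro_hk_convergent[OF Suc g]
      unfolding hk.simps convergent_LIMSEQ_iff by (intro tendsto_rabs tendsto_diff)
    then show "\<bar>hk (Suc k) f - hk (Suc k) g\<bar> \<le> lip (Suc k) C * L1dist f g"
      by (rule LIMSEQ_le_const2) (use cesaro_hk_close[OF Suc f g] in blast)
  next
    fix f assume "local_fun f"
    from cesaro_hk_local[OF Suc this] obtain L where
      "cesaro (\<lambda>n. hk k (mderiv n f)) \<longlonglongrightarrow> L" "cesaro (\<lambda>n. hk k (mderiv n (proj f))) \<longlonglongrightarrow> L" .
    then show "hk (Suc k) f = hk (Suc k) (proj f)" by (simp add: limI)
  qed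
qed

lemma hk_lipschitz:
  "bounded_fun C f \<Longrightarrow> bounded_fun C g \<Longrightarrow> \<bar>hk k f - hk k g\<bar> \<le> lip k C * L1dist f g"
  using hk_regular[of k] by (simp add: hk_regular_def)

lemma hk_tendsto:
  assumes "bounded_fun C f"
  shows "cesaro (\<lambda>n. hk k (mderiv n f)) \<longlonglongrightarrow> hk (Suc k) f"
  using cesaro_hk_convergent[OF hk_regular assms, of k] by (simp add: convergent_LIMSEQ_iff)

lemma le_every_multiple_imp_0:
  fixes x K :: real
  assumes "\<And>\<epsilon>. \<epsilon> > 0 \<Longrightarrow> x \<le> K * \<epsilon>" "K \<ge> 0"
  shows "x \<le> 0"
proof (rule field_le_epsilon)
  fix e :: real assume "e > 0"
  then have "x \<le> K * (e / (K + 1))" using assms by (intro assms(1)) simp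
  also have "\<dots> \<le> e" using \<open>e > 0\<close> assms(2) by (intro mult_divide_add1_le) auto
  finally show "x \<le> 0 + e" by simp
qed

lemma hk_proj:
  assumes f: "bounded_fun C f" shows "hk k (proj f) = hk k f"
proof -
  have l: "lip k C \<ge> 0" by (rule lip_nonneg[OF bounded_fun_nonneg[OF f]])
  have "\<bar>hk k f - hk k (proj f)\<bar> \<le> 0"
  proof (rule le_every_multiple_imp_0)
    fix \<epsilon> :: real assume "\<epsilon> > 0"
    from local_dense[OF f this] obtain g where g: "local_fun g" "bounded_fun C g" "L1dist f g < \<epsilon>" .
    have "hk k g = hk k (proj g)" using hk_regular[of k] g(1) by (simp add: hk_regular_def)
    moreover have "\<bar>hk k f - hk k g\<bar> \<le> lip k C * L1dist f g" by (rule hk_lipschitz[OF f g(2)])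
    moreover have "\<bar>hk k (proj f) - hk k (proj g)\<bar> \<le> lip k C * L1dist (proj f) (proj g)"
      by (rule hk_lipschitz[OF proj_bounded[OF f] proj_bounded[OF g(2)]])
    moreover have "lip k C * L1dist f g \<le> lip k C * \<epsilon>" "lip k C * L1dist (proj f) (proj g) \<le> lip k C * \<epsilon>"
      using g(3) L1dist_proj_le[OF f g(2)] l by (auto intro!: mult_left_mono)
    ultimately show "\<bar>hk k f - hk k (proj f)\<bar> \<le> (2 * lip k C) * \<epsilon>" by linarith
  qed (use l in simp)
  then show ?thesis by simp
qed

lemma hk_zero: "hk k (\<lambda>_. 0) = 0"
proof (induction k)
  case (Suc k)
  have [simp]: "mderiv n (\<lambda>_. 0) = (\<lambda>_. 0)" for n by (simp add: mderiv_def fun_eq_iff)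
  have "cesaro (\<lambda>n. hk k (mderiv n (\<lambda>_. 0))) = (\<lambda>_. 0)" by (rule ext) (simp add: cesaro_def Suc)
  then show ?case by (simp add: limI)
qed simp

lemma hk_nonneg: "bounded_fun C f \<Longrightarrow> 0 \<le> hk k f"
proof (induction k arbitrary: C f)
  case (Suc k)
  show ?case
  proof (rule LIMSEQ_le_const[OF hk_tendsto[OF Suc.prems]], intro exI allI impI)
    show "0 \<le> cesaro (\<lambda>n. hk k (mderiv n f)) N" for N
      using Suc.IH[OF mderiv_bounded[OF Suc.prems]] by (simp add: cesaro_def sum_nonneg)
  qed
qed simp

lemma hk_cong_AE:
  assumes f: "bounded_fun C f" and g: "bounded_fun D g" and eq: "AE p in M. f p = g p"
  shows "hk k f = hk k g"
proof -
  have "L1dist f g = (\<integral>p. 0 \<partial>M)"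
    unfolding L1dist_def
    using eq bounded_fun_measurable[OF f] bounded_fun_measurable[OF g]
    by (intro integral_cong_AE) (auto elim: eventually_mono)
  moreover have "bounded_fun (max C D) f" "bounded_fun (max C D) g"
    using f g by (auto simp: bounded_fun_def le_max_iff_disj)
  ultimately show ?thesis using hk_lipschitz[of "max C D" f g k] by simp
qed

text \<open>Eventually the correlations are those of the projections, which are periodic in \<open>n\<close>, and the average of
\<open>proj g\<close> over a full orbit is its integral.\<close>

lemma mean_ergodic_local:
  assumes f: "local_fun f" and g: "local_fun g"
  shows "cesaro (\<lambda>n. \<integral>p. f p * g ((T ^^ n) p) \<partial>M) \<longlonglongrightarrow> (\<integral>p. f p \<partial>M) * (\<integral>p. g p \<partial>M)"
proof -
  obtain n0 where n0: "\<And>n p. n \<ge> n0 \<Longrightarrow> proj (\<lambda>p. f p * g ((T ^^ n) p)) p = proj f p * proj g ((T ^^ n) p)"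
    using proj_local_correlation[OF f g] by blast
  obtain C where C: "bounded_fun C f" using local_fun_bounded[OF f] .
  obtain D where D: "bounded_fun D g" using local_fun_bounded[OF g] .
  obtain J where J: "finite J" "\<And>i. i \<in> J \<Longrightarrow> odd i" "determined_by J (proj g)"
    using local_fun_proj_odd[OF g] by blast
  define m where "m = (\<Prod>i\<in>J. s i)"
  have m: "m > 0" unfolding m_def by (simp add: prod_pos s_pos)
  define c where "c n = (\<integral>p. proj f p * proj g ((T ^^ n) p) \<partial>M)" for n
  have "c (n + m) = c n" for n
    using odd_period[OF J(2,1,3), of n] by (simp add: c_def m_def)
  from cesaro_periodic[of c m, OF this m] have "cesaro c \<longlonglongrightarrow> (\<Sum>n<m. c n) / of_nat m" .
  also have "(\<Sum>n<m. c n) = (\<integral>p. (\<Sum>n<m. proj f p * proj g ((T ^^ n) p)) \<partial>M)"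
    unfolding c_def
    by (rule Bochner_Integration.integral_sum[symmetric])
      (rule bounded_fun_integrable[OF bounded_fun_mult[OF proj_bounded[OF C] bounded_fun_T_pow[OF proj_bounded[OF D]]]])
  also have "\<dots> = (\<integral>p. proj f p * (of_nat m * (\<integral>p. proj g p \<partial>M)) \<partial>M)"
  proof (intro Bochner_Integration.integral_cong refl)
    fix p
    have "(\<Sum>n<m. proj g ((T ^^ n) p)) = of_nat m * (\<integral>p. proj g p \<partial>M)"
      unfolding m_def by (rule orbit_sum_odd[OF J(2,1,3)])
    then show "(\<Sum>n<m. proj f p * proj g ((T ^^ n) p)) = proj f p * (of_nat m * (\<integral>p. proj g p \<partial>M))"
      by (simp only: sum_distrib_left[symmetric])
  qed
  also have "\<dots> / of_nat m = (\<integral>p. f p \<partial>M) * (\<integral>p. g p \<partial>M)"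
    using m by (simp add: integral_proj[OF C] integral_proj[OF D])
  finally have lim: "cesaro c \<longlonglongrightarrow> (\<integral>p. f p \<partial>M) * (\<integral>p. g p \<partial>M)" .
  have "(\<integral>p. f p * g ((T ^^ n) p) \<partial>M) = c n" if "n \<ge> n0" for n
    unfolding c_def n0[OF that, symmetric]
    by (rule integral_proj[symmetric, OF bounded_fun_mult[OF C bounded_fun_T_pow[OF D]]])
  from cesaro_eventually_eq[OF this lim] show ?thesis .
qed

lemma mean_ergodic:
  assumes f: "bounded_fun C f" and g: "bounded_fun C g"
  shows "cesaro (\<lambda>n. \<integral>p. f p * g ((T ^^ n) p) \<partial>M) \<longlonglongrightarrow> (\<integral>p. f p \<partial>M) * (\<integral>p. g p \<partial>M)"
proof (rule tendsto_by_approximation)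
  fix \<epsilon> :: real assume \<epsilon>: "\<epsilon> > 0"
  have C: "C \<ge> 0" by (rule bounded_fun_nonneg[OF f])
  define \<delta> where "\<delta> = \<epsilon> / (2 * C + 1)"
  have "C * (\<delta> + \<delta>) = 2 * C * (\<epsilon> / (2 * C + 1))" unfolding \<delta>_def by (simp add: mult.commute)
  also have "\<dots> \<le> \<epsilon>" using \<epsilon> C by (intro mult_divide_add1_le) auto
  finally have \<delta>: "C * (\<delta> + \<delta>) \<le> \<epsilon>" "\<delta> > 0" using \<epsilon> C by (auto simp: \<delta>_def)
  obtain f' where f': "local_fun f'" "bounded_fun C f'" "L1dist f f' < \<delta>" using local_dense[OF f \<delta>(2)] .
  obtain g' where g': "local_fun g'" "bounded_fun C g'" "L1dist g g' < \<delta>" using local_dense[OF g \<delta>(2)] .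
  have le: "C * (L1dist f f' + L1dist g g') \<le> \<epsilon>"
    using f'(3) g'(3) C by (intro order_trans[OF _ \<delta>(1)] mult_left_mono) auto
  have "cmod ((\<integral>p. f p * g ((T ^^ n) p) \<partial>M) - (\<integral>p. f' p * g' ((T ^^ n) p) \<partial>M)) \<le> \<epsilon>" for n
    using cmod_integral_diff_le[OF bounded_fun_mult[OF f bounded_fun_T_pow[OF g]]
        bounded_fun_mult[OF f'(2) bounded_fun_T_pow[OF g'(2)]], of n n]
      L1dist_mult_T_pow[OF f f'(2) g g'(2), of n] le by linarith
  from cesaro_norm_diff_le[OF this]
  have 1: "cmod (cesaro (\<lambda>n. \<integral>p. f p * g ((T ^^ n) p) \<partial>M) N - cesaro (\<lambda>n. \<integral>p. f' p * g' ((T ^^ n) p) \<partial>M) N) \<le> \<epsilon>"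
    for N .
  let ?a = "\<integral>p. f p \<partial>M" and ?b = "\<integral>p. g p \<partial>M" and ?a' = "\<integral>p. f' p \<partial>M" and ?b' = "\<integral>p. g' p \<partial>M"
  have "?a * ?b - ?a' * ?b' = ?b * (?a - ?a') + ?a' * (?b - ?b')" by (simp add: algebra_simps)
  then have "cmod (?a * ?b - ?a' * ?b') \<le> cmod ?b * cmod (?a - ?a') + cmod ?a' * cmod (?b - ?b')"
    by (metis norm_mult norm_triangle_ineq)
  also have "\<dots> \<le> C * L1dist f f' + C * L1dist g g'"
    using C by (intro add_mono mult_mono cmod_integral_le[OF g] cmod_integral_le[OF f'(2)]
        cmod_integral_diff_le[OF f f'(2)] cmod_integral_diff_le[OF g g'(2)]) auto
  also have "\<dots> \<le> \<epsilon>" using le by (simp add: algebra_simps)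
  finally have 2: "cmod (?a * ?b - ?a' * ?b') \<le> \<epsilon>" .
  show "\<exists>Y l. Y \<longlonglongrightarrow> l \<and> (\<forall>n. cmod (cesaro (\<lambda>n. \<integral>p. f p * g ((T ^^ n) p) \<partial>M) n - Y n) \<le> \<epsilon>) \<and>
      cmod (?a * ?b - l) \<le> \<epsilon>"
    using mean_ergodic_local[OF f'(1) g'(1)] 1 2 by blast
qed

text \<open>The Cauchy--Schwarz inequality for averages propagates the inequality from one order to the next. At the
lowest order it is combined with the mean ergodic theorem.\<close>

lemma hk_mono:
  assumes "bounded_fun C f" shows "(hk k f)\<^sup>2 \<le> hk (Suc k) f"
  using assms
proof (induction k arbitrary: C f)
  case 0
  let ?c = "\<lambda>n. \<integral>p. mderiv n f p \<partial>M"
  have "cesaro ?c \<longlonglongrightarrow> cnj (\<integral>p. f p \<partial>M) * (\<integral>p. f p \<partial>M)"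
    using mean_ergodic[OF bounded_fun_cnj[OF 0] 0] by (simp add: mderiv_def)
  then have lim: "(\<lambda>N. (cmod (cesaro ?c N))\<^sup>2) \<longlonglongrightarrow> (cmod (cnj (\<integral>p. f p \<partial>M) * (\<integral>p. f p \<partial>M)))\<^sup>2"
    by (intro tendsto_power tendsto_norm)
  have "(cmod (cesaro ?c N))\<^sup>2 \<le> cesaro (\<lambda>n. hk 0 (mderiv n f)) N" for N
    using power_mono[OF cmod_cesaro_le[of ?c N], of 2] cesaro_square_le[of "\<lambda>n. cmod (?c n)" N] by simp
  then have "(cmod (cnj (\<integral>p. f p \<partial>M) * (\<integral>p. f p \<partial>M)))\<^sup>2 \<le> hk (Suc 0) f"
    by (intro LIMSEQ_le[OF lim hk_tendsto[OF 0]]) auto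
  then show ?case by (simp add: norm_mult power2_eq_square)
next
  case (Suc k)
  have lim: "(\<lambda>N. (cesaro (\<lambda>n. hk k (mderiv n f)) N)\<^sup>2) \<longlonglongrightarrow> (hk (Suc k) f)\<^sup>2"
    by (intro tendsto_power hk_tendsto[OF Suc.prems])
  have "(cesaro (\<lambda>n. hk k (mderiv n f)) N)\<^sup>2 \<le> cesaro (\<lambda>n. hk (Suc k) (mderiv n f)) N" for N
    by (rule order_trans[OF cesaro_square_le cesaro_mono]) (rule Suc.IH[OF mderiv_bounded[OF Suc.prems]])
  then show ?case by (intro LIMSEQ_le[OF lim hk_tendsto[OF Suc.prems]] exI allI impI)
qed

section \<open>Eigenfunctions and the pro-nilfactors\<close>

definition eigenfunction :: "(point \<Rightarrow> complex) \<Rightarrow> bool" where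
  "eigenfunction \<xi> \<longleftrightarrow> \<xi> \<in> borel_measurable borel \<and> (\<forall>p. cmod (\<xi> p) = 1) \<and> (\<exists>c. cmod c = 1 \<and> (\<forall>p. \<xi> (T p) = c * \<xi> p))"

lemma eigenfunction_bounded: "eigenfunction \<xi> \<Longrightarrow> bounded_fun 1 \<xi>"
  by (auto simp: eigenfunction_def bounded_fun_def)

lemma eigenfunction_one: "eigenfunction (\<lambda>_. 1)"
  unfolding eigenfunction_def by (auto intro: exI[of _ 1])

lemma eigenfunction_mult:
  assumes "eigenfunction \<xi>" "eigenfunction \<psi>" shows "eigenfunction (\<lambda>p. \<xi> p * \<psi> p)"
proof -
  obtain c d where c: "cmod c = 1" "\<And>p. \<xi> (T p) = c * \<xi> p" and d: "cmod d = 1" "\<And>p. \<psi> (T p) = d * \<psi> p"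
    using assms by (auto simp: eigenfunction_def)
  show ?thesis
    unfolding eigenfunction_def
  proof (intro conjI allI exI)
    show "(\<lambda>p. \<xi> p * \<psi> p) \<in> borel_measurable borel" using assms by (auto simp: eigenfunction_def)
    show "cmod (\<xi> p * \<psi> p) = 1" for p using assms by (auto simp: eigenfunction_def norm_mult)
    show "cmod (c * d) = 1" by (simp add: c d norm_mult)
    show "\<xi> (T p) * \<psi> (T p) = (c * d) * (\<xi> p * \<psi> p)" for p by (simp add: c d)
  qed
qed

text \<open>The multiplicative derivative changes only by a constant factor of modulus \<open>1\<close>.\<close>

lemma hk_1_mult_eigenfunction:
  assumes "eigenfunction \<xi>" shows "hk 1 (\<lambda>p. f p * \<xi> p) = hk 1 f"
proof -
  obtain c where c: "cmod c = 1" "\<And>p. \<xi> (T p) = c * \<xi> p" and \<xi>: "\<And>p. cmod (\<xi> p) = 1"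
    using assms by (auto simp: eigenfunction_def)
  have pow: "\<xi> ((T ^^ n) p) = c ^ n * \<xi> p" for n p by (induction n) (auto simp: c)
  have one: "cnj (\<xi> p) * \<xi> p = 1" for p
    using complex_norm_square[of "\<xi> p"] \<xi>[of p] by (simp add: mult.commute)
  have "mderiv n (\<lambda>p. f p * \<xi> p) p = c ^ n * mderiv n f p" for n p
  proof -
    have "mderiv n (\<lambda>p. f p * \<xi> p) p = c ^ n * mderiv n f p * (cnj (\<xi> p) * \<xi> p)"
      by (simp add: mderiv_def pow)
    then show ?thesis by (simp add: one)
  qed
  then have "mderiv n (\<lambda>p. f p * \<xi> p) = (\<lambda>p. c ^ n * mderiv n f p)" for n by (simp add: fun_eq_iff)
  then show ?thesis by (simp add: norm_mult norm_power c(1) cong: if_cong)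
qed

text \<open>The seminorm of order \<open>2\<close> dominates the integral and ignores the factor \<open>\<xi>\<close>.\<close>

lemma hk_1_zero_orthogonal:
  assumes f: "bounded_fun C f" "hk 1 f = 0" and \<xi>: "eigenfunction \<xi>"
  shows "(\<integral>p. f p * \<xi> p \<partial>M) = 0"
proof -
  have "hk 1 (\<lambda>p. f p * \<xi> p) = 0" using hk_1_mult_eigenfunction[OF \<xi>, of f] f(2) by simp
  then have "(hk 0 (\<lambda>p. f p * \<xi> p))\<^sup>2 \<le> 0"
    using hk_mono[OF bounded_fun_mult[OF f(1) eigenfunction_bounded[OF \<xi>]], of 0] by simp
  then show ?thesis by simp
qed

definition root_of_unity :: "nat \<Rightarrow> complex" where
  "root_of_unity m = cis (2 * pi / real m)"

lemma root_of_unity_pow: "m > 0 \<Longrightarrow> root_of_unity m ^ k = cis (2 * pi * real k / real m)"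
  unfolding root_of_unity_def Complex.DeMoivre by (simp add: mult_ac)

lemma root_of_unity_pow_self: "m > 0 \<Longrightarrow> root_of_unity m ^ m = 1"
  by (simp add: root_of_unity_pow)

lemma root_of_unity_pow_mod: "m > 0 \<Longrightarrow> root_of_unity m ^ (k mod m) = root_of_unity m ^ k"
  using root_of_unity_pow_self[of m]
  by (metis div_mult_mod_eq mult.commute mult_1 power_add power_mult power_one)

lemma root_of_unity_inj:
  assumes "r < m" "v < m" "root_of_unity m ^ r = root_of_unity m ^ v" shows "r = v"
proof -
  have "m > 0" using assms by simp
  from bij_betw_imp_inj_on[OF Complex.bij_betw_roots_unity[OF this]] show ?thesis
    using assms \<open>m > 0\<close> by (auto simp: inj_on_def root_of_unity_pow)
qed

lemma cmod_root_of_unity [simp]: "cmod (root_of_unity m) = 1"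
  by (simp add: root_of_unity_def)

text \<open>The orthogonality of the characters of a cyclic group.\<close>

lemma sum_roots_of_unity:
  assumes "r < m" "v < m"
  shows "(\<Sum>a<m. (root_of_unity m ^ r / root_of_unity m ^ v) ^ a) = (if r = v then of_nat m else 0)"
proof (cases "r = v")
  case True
  have "root_of_unity m \<noteq> 0" using cmod_root_of_unity[of m] by (metis norm_zero zero_neq_one)
  then show ?thesis using True by simp
next
  case False
  let ?z = "root_of_unity m ^ r / root_of_unity m ^ v"
  have m: "m > 0" using assms by simp
  have nz: "root_of_unity m \<noteq> 0" using cmod_root_of_unity[of m] by (metis norm_zero zero_neq_one)
  have "?z \<noteq> 1" using root_of_unity_inj[OF assms] False nz by auto
  moreover have "?z ^ m = 1"
  proof -
    have "(root_of_unity m ^ k) ^ m = 1" for k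
      using root_of_unity_pow_self[OF m] by (metis power_commutes power_mult mult.commute power_one)
    then show ?thesis by (simp add: power_divide)
  qed
  ultimately show ?thesis using False by (simp add: geometric_sum)
qed

lemma eigenfunction_res:
  assumes "odd i" shows "eigenfunction (\<lambda>p. (root_of_unity (s i) ^ res i p) ^ a)"
  unfolding eigenfunction_def
proof (intro conjI allI exI)
  show "(\<lambda>p. (root_of_unity (s i) ^ res i p) ^ a) \<in> borel_measurable borel"
    by (rule determined_by_measurable[OF _ determined_by_res]) auto
  show "cmod ((root_of_unity (s i) ^ res i p) ^ a) = 1" for p by (simp add: norm_power)
  show "cmod (root_of_unity (s i) ^ a) = 1" by (simp add: norm_power)
  show "(root_of_unity (s i) ^ res i (T p)) ^ a = root_of_unity (s i) ^ a * (root_of_unity (s i) ^ res i p) ^ a" for p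
    using assms s_pos[of i] by (simp add: res_T_odd root_of_unity_pow_mod power_mult_distrib)
qed

text \<open>The coordinates in \<open>J\<close> are removed one at a time: fixing the value of the coordinate \<open>j\<close> amounts to
averaging over the characters of that coordinate, which are absorbed by the eigenfunction \<open>\<xi>\<close>.\<close>

lemma hk_1_zero_orthogonal_odd:
  assumes f: "bounded_fun C f" "hk 1 f = 0"
    and "finite J" "\<And>i. i \<in> J \<Longrightarrow> odd i" "determined_by J \<phi>" "eigenfunction \<xi>"
  shows "(\<integral>p. f p * \<xi> p * \<phi> p \<partial>M) = 0"
  using assms(3-)
proof (induction J arbitrary: \<phi> \<xi> rule: finite_induct)
  case empty
  have "\<phi> p = \<phi> undefined" for p by (rule determined_byD[OF empty(2)]) simp
  then have "(\<integral>p. f p * \<xi> p * \<phi> p \<partial>M) = (\<integral>p. f p * \<xi> p * \<phi> undefined \<partial>M)"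
    by (intro Bochner_Integration.integral_cong refl) metis
  then show ?case using hk_1_zero_orthogonal[OF f empty(3)] by simp
next
  case (insert j J)
  let ?z = "root_of_unity (s j)"
  \<comment> \<open>The function \<open>\<phi>\<close> with the coordinate \<open>j\<close> frozen to \<open>v\<close>.\<close>
  define \<phi>' where "\<phi>' v p = \<phi> (fst p, (snd p)(j := real v))" for v p
  have j: "odd j" using insert.prems(1) by simp
  have res': "res i (fst p, (snd p)(j := real v)) = (if i = j then v else res i p)" if "v < s j" for i v p
    using that by (auto simp: res_def nat_mod_distrib)
  have \<phi>'_det: "determined_by J (\<phi>' v)" if "v < s j" for v
    unfolding determined_by_def \<phi>'_def
    by (intro allI impI determined_byD[OF insert.prems(2)]) (auto simp: res'[OF that])
  have \<xi>': "eigenfunction (\<lambda>p. \<xi> p * (?z ^ res j p) ^ a)" for a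
    by (rule eigenfunction_mult[OF insert.prems(3) eigenfunction_res[OF j]])
  have expand: "\<phi> p = (\<Sum>v<s j. (\<Sum>a<s j. (?z ^ res j p / ?z ^ v) ^ a) / of_nat (s j) * \<phi>' v p)" for p
  proof -
    have "\<phi> p = \<phi>' (res j p) p"
      unfolding \<phi>'_def by (rule determined_byD[OF insert.prems(2)]) (simp add: res' res_less)
    also have "\<dots> = (\<Sum>v<s j. (if res j p = v then 1 else 0) * \<phi>' v p)"
      using res_less[of j p] by (simp add: if_distrib[of "\<lambda>x. x * _"] cong: if_cong)
    also have "\<dots> = (\<Sum>v<s j. (\<Sum>a<s j. (?z ^ res j p / ?z ^ v) ^ a) / of_nat (s j) * \<phi>' v p)"
    proof (intro sum.cong refl)
      fix v assume "v \<in> {..<s j}"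
      then show "(if res j p = v then 1 else 0) * \<phi>' v p
          = (\<Sum>a<s j. (?z ^ res j p / ?z ^ v) ^ a) / of_nat (s j) * \<phi>' v p"
        using s_pos[of j] by (simp add: sum_roots_of_unity[OF res_less])
    qed
    finally show ?thesis .
  qed
  have expand': "f p * \<xi> p * \<phi> p = (\<Sum>v<s j. \<Sum>a<s j.
      (1 / ((?z ^ v) ^ a * of_nat (s j))) * (f p * (\<xi> p * (?z ^ res j p) ^ a) * \<phi>' v p))" for p
    by (subst expand) (simp add: sum_distrib_left sum_distrib_right sum_divide_distrib power_divide mult_ac)
  have int: "integrable M (\<lambda>p. f p * (\<xi> p * (?z ^ res j p) ^ a) * \<phi>' v p)" if "v < s j" for a v
  proof -
    have "local_fun (\<phi>' v)" using \<phi>'_det[OF that] insert.hyps(1) by (auto simp: local_fun_def)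
    then obtain D where "bounded_fun D (\<phi>' v)" by (rule local_fun_bounded)
    then show ?thesis
      by (intro bounded_fun_integrable[OF bounded_fun_mult[OF bounded_fun_mult[OF f(1) eigenfunction_bounded[OF \<xi>']]]])
  qed
  have zero: "(\<integral>p. f p * (\<xi> p * (?z ^ res j p) ^ a) * \<phi>' v p \<partial>M) = 0" if "v < s j" for a v
    by (rule insert.IH[OF _ \<phi>'_det[OF that] \<xi>']) (use insert.prems(1) in auto)
  define F where "F v a p =
      (1 / ((?z ^ v) ^ a * of_nat (s j))) * (f p * (\<xi> p * (?z ^ res j p) ^ a) * \<phi>' v p)" for v a p
  have F: "integrable M (F v a)" "(\<integral>p. F v a p \<partial>M) = 0" if "v < s j" for v a
    unfolding F_def integral_mult_right_zero zero[OF that] using int[OF that] by auto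
  have "(\<integral>p. f p * \<xi> p * \<phi> p \<partial>M) = (\<integral>p. (\<Sum>v<s j. \<Sum>a<s j. F v a p) \<partial>M)"
    unfolding expand' F_def ..
  also have "\<dots> = (\<Sum>v<s j. (\<integral>p. (\<Sum>a<s j. F v a p) \<partial>M))"
    by (intro Bochner_Integration.integral_sum Bochner_Integration.integrable_sum F) simp
  also have "\<dots> = (\<Sum>v<s j. \<Sum>a<s j. (\<integral>p. F v a p \<partial>M))"
    by (intro sum.cong refl Bochner_Integration.integral_sum F) simp
  also have "\<dots> = 0" using F(2) by simp
  finally show ?case .
qed

text \<open>The function \<open>f\<close> is orthogonal to \<open>proj g\<close> for local \<open>g\<close>. As \<open>g\<close> tends to \<open>f\<close>, this becomes the
statement that \<open>proj f\<close> is orthogonal to itself.\<close>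

lemma hk_1_zero_imp_proj_zero:
  assumes f: "bounded_fun C f" "hk 1 f = 0"
  shows "AE p in M. proj f p = 0"
proof -
  let ?sq = "\<lambda>p. cnj (proj f p) * proj f p"
  note pf = proj_bounded[OF f(1)]
  have C: "C \<ge> 0" by (rule bounded_fun_nonneg[OF f(1)])
  have sq: "bounded_fun (C * C) ?sq" by (intro bounded_fun_mult bounded_fun_cnj pf)
  have "cmod (\<integral>p. ?sq p \<partial>M) \<le> 0"
  proof (rule le_every_multiple_imp_0[OF _ C])
    fix \<epsilon> :: real assume "\<epsilon> > 0"
    from local_dense[OF f(1) this] obtain g where g: "local_fun g" "bounded_fun C g" "L1dist f g < \<epsilon>" .
    obtain J where J: "finite J" "\<And>i. i \<in> J \<Longrightarrow> odd i" "determined_by J (proj g)"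
      using local_fun_proj_odd[OF g(1)] by blast
    let ?h = "\<lambda>p. cnj (proj g p)"
    have h: "bounded_fun C ?h" by (intro bounded_fun_cnj proj_bounded g(2))
    have "(\<integral>p. f p * 1 * ?h p \<partial>M) = 0"
      by (rule hk_1_zero_orthogonal_odd[OF f J(1,2) determined_by_comp[OF J(3)] eigenfunction_one])
    then have "0 = (\<integral>p. proj (\<lambda>p. ?h p * f p) p \<partial>M)"
      using integral_proj[OF bounded_fun_mult[OF h f(1)]] by (simp add: mult.commute)
    also have "\<dots> = (\<integral>p. ?h p * proj f p \<partial>M)"
      by (intro Bochner_Integration.integral_cong refl proj_mult_left) (simp add: proj_join)
    finally have zero: "(\<integral>p. ?h p * proj f p \<partial>M) = 0" by simp
    have "cmod (\<integral>p. ?sq p \<partial>M) \<le> L1dist ?sq (\<lambda>p. ?h p * proj f p)"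
      using cmod_integral_diff_le[OF sq bounded_fun_mult[OF h pf]] zero by simp
    also have "\<dots> \<le> C * (L1dist (\<lambda>p. cnj (proj f p)) ?h + L1dist (proj f) (proj f))"
      using L1dist_mult_T_pow[OF bounded_fun_cnj[OF pf] h pf pf, of 0] by simp
    also have "\<dots> = C * L1dist (proj f) (proj g)"
      unfolding L1dist_cnj by (simp add: L1dist_def)
    also have "\<dots> \<le> C * \<epsilon>" using L1dist_proj_le[OF f(1) g(2)] g(3) C by (intro mult_left_mono) auto
    finally show "cmod (\<integral>p. ?sq p \<partial>M) \<le> C * \<epsilon>" .
  qed
  then have "(\<integral>p. ?sq p \<partial>M) = 0" by simp
  moreover have sq_eq: "?sq p = complex_of_real ((cmod (proj f p))\<^sup>2)" for p
    by (simp add: complex_norm_square mult.commute del: of_real_power)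
  ultimately have "(\<integral>p. (cmod (proj f p))\<^sup>2 \<partial>M) = 0"
    by (simp only: integral_complex_of_real of_real_eq_0_iff)
  moreover have "integrable M (\<lambda>p. (cmod (proj f p))\<^sup>2)"
    using integrable_Re[OF bounded_fun_integrable[OF sq]] unfolding sq_eq Re_complex_of_real .
  ultimately show ?thesis by (subst (asm) integral_nonneg_eq_0_iff_AE) auto
qed

theorem proj_zero_iff_hk_zero:
  assumes f: "bounded_fun C f" and "k \<ge> 1"
  shows "(AE p in M. proj f p = 0) \<longleftrightarrow> hk k f = 0"
proof
  assume "AE p in M. proj f p = 0"
  then have "hk k (proj f) = hk k (\<lambda>_. 0)"
    by (intro hk_cong_AE[OF proj_bounded[OF f], of 0]) (auto simp: bounded_fun_def)
  then show "hk k f = 0" by (simp add: hk_proj[OF f] hk_zero)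
next
  assume "hk k f = 0"
  have "hk 1 f = 0"
    using \<open>k \<ge> 1\<close> \<open>hk k f = 0\<close>
  proof (induction k rule: dec_induct)
    case (step k)
    have "(hk k f)\<^sup>2 \<le> 0" using hk_mono[OF f, of k] step.prems by (simp only:)
    then show ?case using step.IH by simp
  qed
  then show "AE p in M. proj f p = 0" by (rule hk_1_zero_imp_proj_zero[OF f])
qed

lemma the_inv_T: "the_inv_into UNIV T = T_inv"
  by (rule ext, rule the_inv_into_f_eq) (use bij_T in \<open>auto simp: bij_def\<close>)

lemma standard_probability_space_M: "standard_probability_space M"
  unfolding standard_probability_space_def
proof (intro conjI exI)
  show "prob_space M" by (rule prob_space_axioms)
  show "topspace euclidean = space M" by simp
  show "completely_metrizable_space (euclidean :: point topology)"
    by (rule completely_metrizable_space_euclidean)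
  show "separable_space (euclidean :: point topology)"
  proof -
    obtain D :: "point set" where D: "countable D" "\<And>U. open U \<Longrightarrow> U \<noteq> {} \<Longrightarrow> \<exists>d\<in>D. d \<in> U"
      by (rule countable_dense_setE) blast
    have "x \<in> closure D" for x
      unfolding closure_iff_nhds_not_empty using D(2) by blast
    then have "closure D = UNIV" by blast
    then show ?thesis using D(1) by (auto simp: separable_space_def)
  qed
  show "sets M = sigma_sets (space M) {U. openin euclidean U}"
    by (simp add: borel_def sets_measure_of_conv open_openin[symmetric])
qed

lemma measure_preserving_system_M: "measure_preserving_system M T"
  unfolding measure_preserving_system_def invertible_measure_preserving_def
  using standard_probability_space_M bij_T distr_T by (simp add: the_inv_T)

text \<open>For an invariant event, the mean ergodic theorem gives that its measure is its own square.\<close>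

lemma ergodic_system_M: "ergodic_system M T"
  unfolding ergodic_system_def
proof (intro conjI ballI impI measure_preserving_system_M)
  fix A assume A: "A \<in> sets M" "T -` A \<inter> space M = A"
  have inv: "(T ^^ n) p \<in> A \<longleftrightarrow> p \<in> A" for n p
  proof (induction n)
    case (Suc n)
    have "T q \<in> A \<longleftrightarrow> q \<in> A" for q using A(2) by (metis IntD1 IntI UNIV_I space_M vimageI vimageD)
    then show ?case using Suc by simp
  qed simp
  let ?f = "\<lambda>p. complex_of_real (indicator A p)"
  have f: "bounded_fun 1 ?f" using A(1) by (auto simp: bounded_fun_def indicator_def)
  have "(\<integral>p. ?f p * ?f ((T ^^ n) p) \<partial>M) = of_real (measure M A)" for n
  proof -
    have "(\<integral>p. ?f p * ?f ((T ^^ n) p) \<partial>M) = (\<integral>p. ?f p \<partial>M)"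
      by (intro Bochner_Integration.integral_cong) (auto simp: indicator_def inv)
    then show ?thesis using A(1) by simp
  qed
  then have "cesaro (\<lambda>n. complex_of_real (measure M A)) \<longlonglongrightarrow> of_real (measure M A) * of_real (measure M A)"
    using mean_ergodic[OF f f] A(1) by simp
  moreover have "cesaro (\<lambda>n. complex_of_real (measure M A)) \<longlonglongrightarrow> of_real (measure M A)"
    using cesaro_periodic[of "\<lambda>n. complex_of_real (measure M A)" 1] by simp
  ultimately have "complex_of_real (measure M A) * of_real (measure M A) = of_real (measure M A)"
    by (rule LIMSEQ_unique)
  then have "measure M A * measure M A = measure M A" by (simp only: of_real_mult[symmetric] of_real_eq_iff)
  then show "measure M A = 0 \<or> measure M A = 1" by simp
qed

lemma koopman_nat: "koopman M T (int n) f = (\<lambda>p. f ((T ^^ n) p))"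
  by (simp add: koopman_def transf_power_def o_def)

lemma host_kra_seminorm_eq_hk:
  "bounded_fun C f \<Longrightarrow> host_kra_seminorm M T (Suc k) f = root (2 ^ Suc k) (hk k f)"
proof (induction k arbitrary: C f)
  case 0
  have "root 2 ((cmod (\<integral>p. f p \<partial>M))\<^sup>2) = cmod (\<integral>p. f p \<partial>M)" by (rule real_root_power_cancel) auto
  then show ?case by simp
next
  case (Suc k)
  have "host_kra_seminorm M T (Suc k) (\<lambda>x. cnj (f x) * koopman M T (int n) f x) ^ (2 ^ Suc k) = hk k (mderiv n f)" for n
  proof -
    have "(\<lambda>x. cnj (f x) * koopman M T (int n) f x) = mderiv n f"
      by (simp add: koopman_nat mderiv_def fun_eq_iff)
    then have "host_kra_seminorm M T (Suc k) (\<lambda>x. cnj (f x) * koopman M T (int n) f x)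
        = root (2 ^ Suc k) (hk k (mderiv n f))"
      using Suc.IH[OF mderiv_bounded[OF Suc.prems]] by simp
    then show ?thesis
      using hk_nonneg[OF mderiv_bounded[OF Suc.prems]] by (simp only: real_root_pow_pos2 zero_less_power zero_less_numeral)
  qed
  then show ?case by (simp only: host_kra_seminorm.simps hk.simps cesaro_def[abs_def]) (simp add: divide_inverse mult.commute)
qed

lemma host_kra_seminorm_cong_AE:
  assumes "f \<in> borel_measurable borel" "g \<in> borel_measurable borel" "AE p in M. f p = g p"
  shows "host_kra_seminorm M T (Suc k) f = host_kra_seminorm M T (Suc k) g"
  using assms
proof (induction k arbitrary: f g)
  case 0
  have "(\<integral>p. f p \<partial>M) = (\<integral>p. g p \<partial>M)" using 0 by (intro integral_cong_AE) auto
  then show ?case by simp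
next
  case (Suc k)
  have meas: "(\<lambda>x. cnj (h x) * h ((T ^^ n) x)) \<in> borel_measurable borel" if "h \<in> borel_measurable borel" for h n
  proof -
    have "(\<lambda>x. cnj (h x)) \<in> borel_measurable borel"
      by (rule measurable_compose[OF that borel_measurable_continuous_onI[OF continuous_on_cnj[OF continuous_on_id]]])
    moreover have "(\<lambda>x. h ((T ^^ n) x)) \<in> borel_measurable borel"
      by (rule measurable_compose[OF T_pow_measurable that])
    ultimately show ?thesis by (rule borel_measurable_times)
  qed
  have "host_kra_seminorm M T (Suc k) (\<lambda>x. cnj (f x) * koopman M T (int n) f x)
      = host_kra_seminorm M T (Suc k) (\<lambda>x. cnj (g x) * koopman M T (int n) g x)" for n
    unfolding koopman_nat
  proof (rule Suc.IH[OF meas[OF Suc.prems(1)] meas[OF Suc.prems(2)]])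
    show "AE p in M. cnj (f p) * f ((T ^^ n) p) = cnj (g p) * g ((T ^^ n) p)"
      using Suc.prems(3) AE_T_pow[OF Suc.prems(3), of n] by eventually_elim simp
  qed
  then show ?case by simp
qed

text \<open>The same \<open>\<sigma>\<close>-algebra serves for every step: the rotations are already the whole compact part of
the system. An essentially bounded function is first replaced by a bounded one.\<close>

theorem is_pronilfactor_Z:
  assumes "k \<ge> 1" shows "is_pronilfactor M T k Z"
  unfolding is_pronilfactor_def
proof (intro conjI subalgebra_Z Z_T_invariant ballI)
  fix f assume "f \<in> L_infinity M"
  then obtain C where f: "f \<in> borel_measurable borel" and C: "AE p in M. cmod (f p) \<le> C"
    by (auto simp: L_infinity_def)
  define f' where "f' p = (if cmod (f p) \<le> C then f p else 0)" for p
  have [measurable]: "f \<in> borel_measurable borel" by (rule f)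
  have f'_meas: "f' \<in> borel_measurable borel" unfolding f'_def by measurable
  have f': "bounded_fun (max C 0) f'" using f'_meas by (auto simp: bounded_fun_def f'_def)
  have eq: "AE p in M. f p = f' p" using C by eventually_elim (simp add: f'_def)
  interpret finite_measure_subalgebra M Z
    by unfold_locales (rule subalgebra_Z)
  have "AE p in M. real_cond_exp M Z (\<lambda>y. Re (f y)) p = real_cond_exp M Z (\<lambda>y. Re (f' y)) p"
    using eq f f'_meas by (intro real_cond_exp_cong) auto
  moreover have "AE p in M. real_cond_exp M Z (\<lambda>y. Im (f y)) p = real_cond_exp M Z (\<lambda>y. Im (f' y)) p"
    using eq f f'_meas by (intro real_cond_exp_cong) auto
  ultimately have ce: "AE p in M. complex_cond_exp M Z f p = proj f' p"
    using complex_cond_exp_eq_proj[OF f'] by eventually_elim (simp add: complex_cond_exp_def)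
  have "(AE p in M. complex_cond_exp M Z f p = 0) \<longleftrightarrow> (AE p in M. proj f' p = 0)"
  proof
    assume "AE p in M. complex_cond_exp M Z f p = 0"
    with ce show "AE p in M. proj f' p = 0" by eventually_elim simp
  next
    assume "AE p in M. proj f' p = 0"
    with ce show "AE p in M. complex_cond_exp M Z f p = 0" by eventually_elim simp
  qed
  also have "\<dots> \<longleftrightarrow> hk k f' = 0" by (rule proj_zero_iff_hk_zero[OF f' assms])
  also have "\<dots> \<longleftrightarrow> host_kra_seminorm M T (Suc k) f' = 0"
    using host_kra_seminorm_eq_hk[OF f', of k] by simp
  also have "host_kra_seminorm M T (Suc k) f' = host_kra_seminorm M T (k + 1) f"
    using host_kra_seminorm_cong_AE[OF f f'_meas eq, of k] by simp
  finally show "(AE p in M. complex_cond_exp M Z f p = 0) \<longleftrightarrow> host_kra_seminorm M T (k + 1) f = 0" .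
qed

lemma is_infinite_step_pronilfactor_Z: "is_infinite_step_pronilfactor M T Z"
  unfolding is_infinite_step_pronilfactor_def
proof (intro exI conjI allI impI)
  show "is_pronilfactor M T k Z" if "k \<ge> 1" for k using that by (rule is_pronilfactor_Z)
  have "(\<Union>k\<in>{1::nat..}. sets Z) = odd_events" by auto
  then show "Z = sigma (space M) (\<Union>k\<in>{1::nat..}. sets Z)" by (simp add: Z_def)
qed

end

section \<open>Two sets that avoid each other for a long time\<close>

text \<open>The factor in the growth condition makes the densities of the exceptional return times in
\<open>card_returns_le\<close> a geometric series of small sum.\<close>

locale sparse_primes =
  fixes e :: "nat \<Rightarrow> nat"
  assumes prime_e: "prime (e l)"
    and growth: "e l * 2 ^ (l + 6) < e (Suc l)"

lemma exists_sparse_primes: "\<exists>e. sparse_primes e"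
proof -
  have "\<exists>e :: nat \<Rightarrow> nat. \<forall>l. prime (e l) \<and> e l * 2 ^ (l + 6) < e (Suc l)"
  proof (rule dependent_nat_choice[of "\<lambda>_. prime" "\<lambda>l x y. x * 2 ^ (l + 6) < y"])
    show "\<exists>x::nat. prime x" using two_is_prime_nat by blast
    show "\<exists>y::nat. prime y \<and> x * 2 ^ (l + 6) < y" if "prime x" for x l using bigger_prime by blast
  qed
  then show ?thesis unfolding sparse_primes_def by blast
qed

text \<open>The primes with odd positions in the sequence sit at the positive odd indices, those with positive even
positions at the negative odd ones. The value \<open>2\<close> is the number of values of a random bit.\<close>

definition modulus :: "(nat \<Rightarrow> nat) \<Rightarrow> int \<Rightarrow> nat" where
  "modulus e i = (if even i then 2 else if i > 0 then e (nat i) else e (nat (1 - i)))"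

lemma card_small_residues_le:
  "card {n. n < L \<and> n mod q \<le> N} \<le> (L div q + 1) * (N + 1)" for L q N :: nat
proof -
  have "card {n. n < L \<and> n mod q \<le> N} \<le> card ({..L div q} \<times> {..N})"
  proof (rule card_inj_on_le)
    show "inj_on (\<lambda>n. (n div q, n mod q)) {n. n < L \<and> n mod q \<le> N}"
      by (rule inj_onI) (metis div_mult_mod_eq prod.inject)
    show "(\<lambda>n. (n div q, n mod q)) ` {n. n < L \<and> n mod q \<le> N} \<subseteq> {..L div q} \<times> {..N}"
      by (auto intro: div_le_mono)
  qed auto
  then show ?thesis by (simp add: card_cartesian_product)
qed

context sparse_primes begin

declare split_paired_All [simp del] split_paired_Ex [simp del]

lemma e_less_Suc: "e l < e (Suc l)"
proof -
  have "e l \<le> e l * 2 ^ (l + 6)" by simp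
  then show ?thesis using growth by (rule le_less_trans)
qed

lemma strict_mono_e: "strict_mono e"
  by (rule strict_mono_Suc_iff[THEN iffD2]) (simp add: e_less_Suc)

lemma e_pos: "e l > 0"
  using prime_gt_0_nat[OF prime_e] .

sublocale coprime_rotations "modulus e"
proof
  show "modulus e i > 0" for i by (simp add: modulus_def e_pos)
  show "even i \<Longrightarrow> modulus e i = 2" for i by (simp add: modulus_def)
  fix i j :: int assume *: "odd i" "odd j" "i \<noteq> j"
  have "nat (if i > 0 then i else 1 - i) \<noteq> nat (if j > 0 then j else 1 - j)"
    using * by (auto split: if_splits simp: nat_eq_iff2)
  then have "e (nat (if i > 0 then i else 1 - i)) \<noteq> e (nat (if j > 0 then j else 1 - j))"
    using strict_mono_eq[OF strict_mono_e] by simp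
  then show "coprime (modulus e i) (modulus e j)"
    using * by (auto simp: modulus_def intro!: primes_coprime prime_e split: if_splits)
qed

abbreviation pos :: "nat \<Rightarrow> int" where "pos j \<equiv> 2 * int j + 1"
abbreviation neg :: "nat \<Rightarrow> int" where "neg j \<equiv> - (2 * int j) - 1"

lemma modulus_pos: "modulus e (pos j) = e (2 * j + 1)"
  by (simp add: modulus_def nat_add_distrib nat_mult_distrib)

lemma modulus_neg: "modulus e (neg j) = e (2 * j + 2)"
  by (simp add: modulus_def nat_add_distrib nat_mult_distrib)

text \<open>The number \<open>t\<close> is the time after which the rotation at \<open>pos j\<close> reaches zero.\<close>

definition base_A :: "nat \<Rightarrow> point set" where
  "base_A j = {p. (\<exists>t\<le>e (2 * j). (res (pos j) p + t) mod e (2 * j + 1) = 0) \<and> (\<forall>i\<le>j. res (neg i) p = 0)}"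

definition base_B :: "nat \<Rightarrow> point set" where
  "base_B j = {p. res (neg j) p \<le> e (2 * j) \<and> (\<forall>i\<le>j. res (pos i) p = 0)}"

text \<open>The even index \<open>2l\<close> holds the bit with number \<open>l\<close>.\<close>

definition bits :: "nat \<Rightarrow> nat \<Rightarrow> point set" where
  "bits v k = {p. \<forall>l\<in>{- int k..int k}. res (2 * l) p = v}"

definition A :: "point set" where "A = (\<Union>j. base_A j \<inter> bits 0 (e (2 * j)))"
definition B :: "point set" where "B = (\<Union>j. base_B j \<inter> bits 1 (e (2 * j)))"

lemma bits_measurable [measurable]: "bits v k \<in> sets borel"
  unfolding bits_def by measurable

lemma bitsD: "p \<in> bits v k \<Longrightarrow> \<bar>l\<bar> \<le> int k \<Longrightarrow> res (2 * l) p = v"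
  by (simp add: bits_def abs_le_iff)

lemma A_measurable [measurable]: "A \<in> sets borel"
  unfolding A_def base_A_def by measurable

lemma B_measurable [measurable]: "B \<in> sets borel"
  unfolding B_def base_B_def by measurable

text \<open>If \<open>n\<close> were at most \<open>e (2j)\<close> for the index \<open>j\<close> of the piece of \<open>A\<close>, then its window of zeros would
cover the bit that the piece of \<open>B\<close> requires to be \<open>1\<close>, and similarly for the index \<open>i\<close> of the piece of
\<open>B\<close>. So both indices are less than \<open>k\<close>. The vanishing coordinates of the piece with the larger index
then turn the condition on the piece with the smaller index into one on \<open>n\<close> alone.\<close>

lemma return_imp_small_residue:
  assumes "p \<in> A" "(T ^^ n) p \<in> B" "n \<le> e (2 * k)"
  obtains j where "j < k" "n mod e (2 * j + 1) \<le> e (2 * j) \<or> n mod e (2 * j + 2) \<le> e (2 * j)"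
proof -
  obtain j where j: "p \<in> base_A j" "p \<in> bits 0 (e (2 * j))" using assms(1) by (auto simp: A_def)
  obtain i where i: "(T ^^ n) p \<in> base_B i" "(T ^^ n) p \<in> bits 1 (e (2 * i))" using assms(2) by (auto simp: B_def)
  have nj: "e (2 * j) < n"
  proof (rule ccontr)
    assume "\<not> e (2 * j) < n"
    \<comment> \<open>The bit of \<open>p\<close> with number \<open>n\<close> is the central bit of \<open>T\<^sup>n p\<close>.\<close>
    then have "res (2 * int n) p = 0" by (intro bitsD[OF j(2)]) simp
    moreover have "res (2 * 0) ((T ^^ n) p) = 1" by (rule bitsD[OF i(2)]) simp
    ultimately show False by (simp add: res_T_pow_even)
  qed
  have ni: "e (2 * i) < n"
  proof (rule ccontr)
    assume "\<not> e (2 * i) < n"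
    \<comment> \<open>The central bit of \<open>p\<close> is the bit of \<open>T\<^sup>n p\<close> with number \<open>- n\<close>.\<close>
    then have "res (2 * (- int n)) ((T ^^ n) p) = 1" by (intro bitsD[OF i(2)]) simp
    moreover have "res (2 * 0) p = 0" by (rule bitsD[OF j(2)]) simp
    ultimately show False by (simp add: res_T_pow_even)
  qed
  have "j < k" "i < k"
    using nj ni assms(3) strict_mono_less[OF strict_mono_e] by (metis mult_less_cancel1 order_less_le_trans)+
  show ?thesis
  proof (cases "j \<le> i")
    case True
    obtain t where t: "t \<le> e (2 * j)" "(res (pos j) p + t) mod e (2 * j + 1) = 0" using j(1) by (auto simp: base_A_def)
    have "(res (pos j) p + n) mod e (2 * j + 1) = 0"
      using i(1) True by (auto simp: base_B_def res_T_pow_odd modulus_pos)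
    then have "[res (pos j) p + n = res (pos j) p + t] (mod e (2 * j + 1))" using t(2) by (simp add: cong_def)
    then have "[n = t] (mod e (2 * j + 1))" by (simp only: cong_add_lcancel_nat)
    then have "n mod e (2 * j + 1) = t mod e (2 * j + 1)" by (simp only: cong_def)
    also have "\<dots> \<le> t" by simp
    finally show ?thesis using that[OF \<open>j < k\<close>] t(1) by simp
  next
    case False
    then have "res (neg i) p = 0" using j(1) by (auto simp: base_A_def)
    then have "n mod e (2 * i + 2) \<le> e (2 * i)"
      using i(1) by (auto simp: base_B_def res_T_pow_odd modulus_neg)
    then show ?thesis using that[OF \<open>i < k\<close>] by simp
  qed
qed

text \<open>The residues of \<open>n\<close> that are allowed by the index \<open>j\<close> have density of order at most \<open>e (2j) / e (2j+1)\<close>,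
and the growth of the primes makes these densities summable to less than a half.\<close>

lemma card_returns_le:
  "real (card {n. n < e (2 * k) \<and> (\<exists>p. p \<in> A \<and> (T ^^ n) p \<in> B)}) \<le> real (e (2 * k)) / 2"
proof -
  let ?L = "e (2 * k)"
  have small: "real (card {n. n < ?L \<and> n mod q \<le> e (2 * j)}) \<le> real ?L / 2 ^ (j + 4)"
    if q: "e (2 * j + 1) \<le> q" "q \<le> ?L" for q j
  proof -
    have pos: "real q > 0" using e_pos[of "2 * j + 1"] q by simp
    have N: "real (e (2 * j)) \<ge> 1" using e_pos[of "2 * j"] by linarith
    have "e (2 * j) * 2 ^ (2 * j + 6) \<le> q" using growth[of "2 * j"] q(1) by simp
    then have "real (e (2 * j) * 2 ^ (2 * j + 6)) \<le> real q" by (rule of_nat_mono)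
    then have big: "real (e (2 * j)) * 2 ^ (2 * j + 6) \<le> real q" by simp
    have "real (card {n. n < ?L \<and> n mod q \<le> e (2 * j)}) \<le> real ((?L div q + 1) * (e (2 * j) + 1))"
      by (rule of_nat_mono[OF card_small_residues_le])
    also have "\<dots> \<le> (2 * (real ?L / real q)) * (2 * real (e (2 * j)))"
    proof -
      have "real (?L div q) \<le> real ?L / real q" by (rule of_nat_div_le_of_nat)
      moreover have "1 \<le> real ?L / real q" using q(2) pos by simp
      ultimately have "real (?L div q + 1) \<le> 2 * (real ?L / real q)" by simp
      moreover have "real (e (2 * j) + 1) \<le> 2 * real (e (2 * j))" using N by simp
      ultimately show ?thesis unfolding of_nat_mult by (intro mult_mono) auto
    qed
    also have "\<dots> = real ?L * (4 * real (e (2 * j)) / real q)" by simp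
    also have "\<dots> \<le> real ?L * (1 / 2 ^ (j + 4))"
    proof (rule mult_left_mono)
      have "4 * real (e (2 * j)) * 2 ^ (j + 4) = real (e (2 * j)) * 2 ^ (j + 6)" by (simp add: power_add)
      also have "\<dots> \<le> real (e (2 * j)) * 2 ^ (2 * j + 6)" by (intro mult_left_mono power_increasing) auto
      also have "\<dots> \<le> real q" by (rule big)
      finally show "4 * real (e (2 * j)) / real q \<le> 1 / 2 ^ (j + 4)" using pos by (simp add: field_simps)
    qed simp
    finally show ?thesis by simp
  qed
  let ?S = "\<lambda>j. {n. n < ?L \<and> n mod e (2 * j + 1) \<le> e (2 * j)} \<union> {n. n < ?L \<and> n mod e (2 * j + 2) \<le> e (2 * j)}"
  have "{n. n < ?L \<and> (\<exists>p. p \<in> A \<and> (T ^^ n) p \<in> B)} \<subseteq> (\<Union>j<k. ?S j)"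
  proof
    fix n assume "n \<in> {n. n < ?L \<and> (\<exists>p. p \<in> A \<and> (T ^^ n) p \<in> B)}"
    then obtain p where n: "n < ?L" "p \<in> A" "(T ^^ n) p \<in> B" by blast
    from return_imp_small_residue[OF n(2,3) less_imp_le[OF n(1)]]
    obtain j where "j < k" "n mod e (2 * j + 1) \<le> e (2 * j) \<or> n mod e (2 * j + 2) \<le> e (2 * j)" .
    then show "n \<in> (\<Union>j<k. ?S j)" using n(1) by blast
  qed
  then have "card {n. n < ?L \<and> (\<exists>p. p \<in> A \<and> (T ^^ n) p \<in> B)} \<le> card (\<Union>j<k. ?S j)"
    by (intro card_mono) auto
  also have "\<dots> \<le> (\<Sum>j<k. card (?S j))" by (intro card_UN_le) simp
  finally have "real (card {n. n < ?L \<and> (\<exists>p. p \<in> A \<and> (T ^^ n) p \<in> B)}) \<le> real (\<Sum>j<k. card (?S j))"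
    by (rule of_nat_mono)
  also have "\<dots> = (\<Sum>j<k. real (card (?S j)))" by (rule of_nat_sum)
  also have "\<dots> \<le> (\<Sum>j<k. real ?L / 8 * (1 / 2) ^ j)"
  proof (rule sum_mono)
    fix j assume "j \<in> {..<k}"
    then have "e (2 * j + 1) \<le> ?L" "e (2 * j + 2) \<le> ?L" "e (2 * j + 1) \<le> e (2 * j + 2)"
      using strict_mono_less_eq[OF strict_mono_e] by auto
    then have "real (card (?S j)) \<le> real ?L / 2 ^ (j + 4) + real ?L / 2 ^ (j + 4)"
      using small[of j "e (2 * j + 1)"] small[of j "e (2 * j + 2)"]
      by (intro order_trans[OF of_nat_mono[OF card_Un_le]]) simp
    also have "\<dots> = real ?L / 8 * (1 / 2) ^ j" by (simp add: power_add power_one_over field_simps)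
    finally show "real (card (?S j)) \<le> real ?L / 8 * (1 / 2) ^ j" .
  qed
  also have "\<dots> = real ?L / 8 * (\<Sum>j<k. (1 / 2) ^ j)" by (rule sum_distrib_left[symmetric])
  also have "(\<Sum>j<k. (1 / 2 :: real) ^ j) = 2 - 2 * (1 / 2) ^ k" by (induction k) auto
  also have "real ?L / 8 * (2 - 2 * (1 / 2) ^ k) \<le> real ?L / 8 * 2" by (intro mult_left_mono) auto
  also have "\<dots> \<le> real ?L / 2" by simp
  finally show ?thesis .
qed

abbreviation ind :: "point set \<Rightarrow> point \<Rightarrow> complex" where
  "ind S \<equiv> \<lambda>p. of_real (indicator S p)"

lemma ind_bounded: "S \<in> sets borel \<Longrightarrow> bounded_fun 1 (ind S)"
  by (auto simp: bounded_fun_def indicator_def)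

lemma measure_cylinder_pos:
  assumes "finite J" "\<And>i. i \<in> J \<Longrightarrow> v i < modulus e i"
  shows "measure M {p. \<forall>i\<in>J. res i p = v i} > 0"
  using s_pos by (subst measure_cylinder[OF assms]) (auto intro!: prod_pos)

lemma bits_pos: "v < 2 \<Longrightarrow> measure M (bits v k) > 0"
proof -
  assume "v < 2"
  have "bits v k = {p. \<forall>i\<in>(\<lambda>l. 2 * l) ` {- int k..int k}. res i p = v}" by (simp add: bits_def)
  also have "measure M \<dots> > 0" using \<open>v < 2\<close> by (intro measure_cylinder_pos) (auto simp: modulus_def)
  finally show ?thesis .
qed

lemma join_section_measurable:
  assumes "S \<in> sets borel" shows "{q. join Odd p q \<in> S} \<in> sets M"
proof -
  have "(\<lambda>q. (p, q)) \<in> borel \<rightarrow>\<^sub>M borel \<Otimes>\<^sub>M borel" by measurable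
  from measurable_compose[OF this join_measurable, of Odd]
  have "(\<lambda>q. join Odd p q) \<in> borel_measurable borel" by simp
  from measurable_sets[OF this assms] show ?thesis by (simp add: vimage_def)
qed

lemma Re_proj_ind:
  assumes "S \<in> sets borel"
  shows "Re (proj (ind S) p) = measure M {q. join Odd p q \<in> S}"
proof -
  have m: "{q. join Odd p q \<in> S} \<in> sets borel"
    using join_section_measurable[OF assms] by simp
  have "(\<integral>q. indicat_real S (join Odd p q) \<partial>M) = (\<integral>q. indicat_real {q. join Odd p q \<in> S} q \<partial>M)"
    by (intro Bochner_Integration.integral_cong) (auto simp: indicator_def)
  then show ?thesis using m by (simp add: proj_def)
qed

lemma Re_proj_ind_nonneg: "S \<in> sets borel \<Longrightarrow> 0 \<le> Re (proj (ind S) p)"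
  by (simp add: Re_proj_ind)

lemma join_in_bits: "join Odd p q \<in> bits v k \<longleftrightarrow> q \<in> bits v k"
  by (simp add: bits_def res_join)

lemma join_in_base_A: "join Odd p q \<in> base_A k \<longleftrightarrow> p \<in> base_A k"
  by (simp add: base_A_def res_join)

lemma join_in_base_B: "join Odd p q \<in> base_B k \<longleftrightarrow> p \<in> base_B k"
  by (simp add: base_B_def res_join)

text \<open>Over a base point of the \<open>k\<close>-th piece, the prescribed bits alone contribute this much.\<close>

lemma proj_A_ge: "p \<in> base_A k \<Longrightarrow> measure M (bits 0 (e (2 * k))) \<le> Re (proj (ind A) p)"
  unfolding Re_proj_ind[OF A_measurable]
  by (intro finite_measure_mono join_section_measurable A_measurable)
    (auto simp: A_def join_in_base_A join_in_bits)

lemma proj_B_ge: "p \<in> base_B k \<Longrightarrow> measure M (bits 1 (e (2 * k))) \<le> Re (proj (ind B) p)"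
  unfolding Re_proj_ind[OF B_measurable]
  by (intro finite_measure_mono join_section_measurable B_measurable)
    (auto simp: B_def join_in_base_B join_in_bits)

text \<open>By independence the coordinates \<open>-n\<close> at \<open>pos 0, \<dots>, pos k\<close> and \<open>0\<close> at \<open>neg 0, \<dots>, neg k\<close> occur with
positive probability. They lie in the base of \<open>A\<close>, and after \<open>n\<close> steps in the base of \<open>B\<close>.\<close>

lemma exists_recurrent_cylinder:
  assumes "n \<le> e (2 * k)"
  shows "\<exists>C\<in>sets borel. measure M C > 0 \<and> C \<subseteq> base_A k \<and> C \<subseteq> (T ^^ n) -` base_B k"
proof -
  let ?m = "modulus e"
  \<comment> \<open>The residue of \<open>- n\<close> at the positive indices; the outer \<open>mod\<close> is for multiples of the modulus.\<close>
  define v where "v i = (if i > 0 then (?m i - n mod ?m i) mod ?m i else 0)" for i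
  define J where "J = pos ` {..k} \<union> neg ` {..k}"
  define C where "C = {p. \<forall>i\<in>J. res i p = v i}"
  have "finite J" by (simp add: J_def)
  have v_less: "v i < ?m i" for i using s_pos[of i] by (simp add: v_def)
  have pos: "(res (pos i) p + n) mod e (2 * i + 1) = 0" if "p \<in> C" "i \<le> k" for p i
  proof -
    let ?q = "e (2 * i + 1)"
    have "res (pos i) p = (?q - n mod ?q) mod ?q"
      using that by (auto simp: C_def J_def v_def modulus_pos)
    then have "(res (pos i) p + n) mod ?q = ((?q - n mod ?q) + n mod ?q) mod ?q"
      by (metis mod_add_eq mod_mod_trivial)
    also have "(?q - n mod ?q) + n mod ?q = ?q" using e_pos[of "2 * i + 1"] by simp
    finally show ?thesis by simp
  qed
  have neg: "res (neg i) p = 0" if "p \<in> C" "i \<le> k" for p i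
    using that by (auto simp: C_def J_def v_def)
  show ?thesis
  proof (intro bexI conjI)
    show "C \<in> sets borel" unfolding C_def using \<open>finite J\<close> by measurable
    show "measure M C > 0" unfolding C_def by (rule measure_cylinder_pos[OF \<open>finite J\<close> v_less])
    show "C \<subseteq> base_A k" using pos neg assms by (auto simp: base_A_def)
    show "C \<subseteq> (T ^^ n) -` base_B k"
    proof
      fix p assume "p \<in> C"
      have "n mod e (2 * k + 2) \<le> e (2 * k)" using assms by (rule order_trans[OF mod_less_eq_dividend])
      then have "res (neg k) ((T ^^ n) p) \<le> e (2 * k)"
        using neg[OF \<open>p \<in> C\<close>, of k] by (subst res_T_pow_odd) (simp_all only: modulus_neg, simp_all)
      moreover have "res (pos i) ((T ^^ n) p) = 0" if "i \<le> k" for i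
        using pos[OF \<open>p \<in> C\<close> that] by (subst res_T_pow_odd) (simp_all only: modulus_pos, simp_all)
      ultimately show "p \<in> (T ^^ n) -` base_B k" by (simp add: base_B_def)
    qed
  qed
qed

lemma integral_pos_of_ge_on:
  assumes F: "integrable M F" "\<And>p. 0 \<le> F p" and C: "C \<in> sets borel" "measure M C > 0"
    and ge: "\<And>p. p \<in> C \<Longrightarrow> \<delta> \<le> F p" and "\<delta> > (0::real)"
  shows "(\<integral>p. F p \<partial>M) > 0"
proof -
  have "0 < \<delta> * measure M C" using C(2) \<open>\<delta> > 0\<close> by simp
  also have "\<dots> = (\<integral>p. \<delta> * indicator C p \<partial>M)" using C(1) by simp
  also have "\<dots> \<le> (\<integral>p. F p \<partial>M)"
  proof (rule integral_mono[OF _ F(1)])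
    show "integrable M (\<lambda>p. \<delta> * indicator C p)"
      using C(1) by (intro integrable_mult_right integrable_real_indicator) (auto simp: emeasure_eq_measure)
    show "\<delta> * indicator C p \<le> F p" for p using F(2) ge by (simp add: indicator_def)
  qed
  finally show ?thesis .
qed

lemma measure_eq_integral_proj:
  "S \<in> sets borel \<Longrightarrow> measure M S = (\<integral>p. Re (proj (ind S) p) \<partial>M)"
  using integral_Re[OF bounded_fun_integrable[OF proj_bounded[OF ind_bounded]], of S]
    integral_proj[OF ind_bounded, of S] by simp

lemma measure_A_pos: "measure M A > 0"
proof -
  from exists_recurrent_cylinder[OF le0, of 0]
  obtain C where C: "C \<in> sets borel" "measure M C > 0" "C \<subseteq> base_A 0" by blast
  show ?thesis
    unfolding measure_eq_integral_proj[OF A_measurable]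
    by (rule integral_pos_of_ge_on[OF _ Re_proj_ind_nonneg C(1,2) proj_A_ge[of _ 0] bits_pos])
      (use C(3) in \<open>auto intro!: integrable_Re bounded_fun_integrable[OF proj_bounded[OF ind_bounded]]\<close>)
qed

lemma measure_B_pos: "measure M B > 0"
proof -
  from exists_recurrent_cylinder[OF le0, of 0]
  obtain C where C: "C \<in> sets borel" "measure M C > 0" "C \<subseteq> (T ^^ 0) -` base_B 0" by blast
  show ?thesis
    unfolding measure_eq_integral_proj[OF B_measurable]
    by (rule integral_pos_of_ge_on[OF _ Re_proj_ind_nonneg C(1,2) proj_B_ge[of _ 0] bits_pos])
      (use C(3) in \<open>auto intro!: integrable_Re bounded_fun_integrable[OF proj_bounded[OF ind_bounded]]\<close>)
qed

lemma real_cond_exp_ind: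
  assumes "S \<in> sets borel"
  shows "AE p in M. real_cond_exp M Z (indicator S) p = Re (proj (ind S) p)"
  using real_cond_exp_Re[OF ind_bounded[OF assms]] by simp

lemma correlation_of_projections_pos:
  assumes "n \<le> e (2 * k)"
  shows "(\<integral>p. real_cond_exp M Z (indicator A) p * koopman M T (int n) (real_cond_exp M Z (indicator B)) p \<partial>M) > 0"
proof -
  let ?F = "\<lambda>p. Re (proj (ind A) p) * Re (proj (ind B) ((T ^^ n) p))"
  from exists_recurrent_cylinder[OF assms]
  obtain C where C: "C \<in> sets borel" "measure M C > 0" "C \<subseteq> base_A k" "C \<subseteq> (T ^^ n) -` base_B k" by blast
  note bA = proj_bounded[OF ind_bounded[OF A_measurable]] and bB = proj_bounded[OF ind_bounded[OF B_measurable]]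
  have [measurable]: "proj (ind A) \<in> borel_measurable borel" "proj (ind B) \<in> borel_measurable borel"
    by (rule bounded_fun_measurable[OF bA] bounded_fun_measurable[OF bB])+
  have [measurable]: "real_cond_exp M Z f \<in> borel_measurable borel" for f
    using borel_measurable_cond_exp2[of M Z f] by (simp cong: measurable_cong_sets)
  have "AE p in M. real_cond_exp M Z (indicator A) p * koopman M T (int n) (real_cond_exp M Z (indicator B)) p = ?F p"
    using real_cond_exp_ind[OF A_measurable] AE_T_pow[OF real_cond_exp_ind[OF B_measurable], of n]
    by eventually_elim (simp add: koopman_nat)
  then have "(\<integral>p. real_cond_exp M Z (indicator A) p * koopman M T (int n) (real_cond_exp M Z (indicator B)) p \<partial>M)
      = (\<integral>p. ?F p \<partial>M)"
    unfolding koopman_nat by (intro integral_cong_AE) auto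
  also have "\<dots> > 0"
  proof (rule integral_pos_of_ge_on[OF _ _ C(1,2)])
    show "integrable M ?F"
    proof (rule integrable_const_bound[where B = 1])
      have le: "\<bar>Re (proj (ind S) p)\<bar> \<le> 1" if "S \<in> sets borel" for S p
        using proj_bounded[OF ind_bounded[OF that]] abs_Re_le_cmod order_trans
        unfolding bounded_fun_def by blast
      show "AE p in M. norm (?F p) \<le> 1"
        unfolding real_norm_def abs_mult
        by (intro AE_I2 mult_le_one le A_measurable B_measurable abs_ge_zero)
    qed measurable
    show "0 \<le> ?F p" for p by (intro mult_nonneg_nonneg Re_proj_ind_nonneg) auto
    show "measure M (bits 0 (e (2 * k))) * measure M (bits 1 (e (2 * k))) \<le> ?F p" if "p \<in> C" for p
    proof (intro mult_mono proj_A_ge proj_B_ge Re_proj_ind_nonneg A_measurable measure_nonneg)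
      show "p \<in> base_A k" "(T ^^ n) p \<in> base_B k" using C(3,4) that by auto
    qed
    show "0 < measure M (bits 0 (e (2 * k))) * measure M (bits 1 (e (2 * k)))"
      by (intro mult_pos_pos bits_pos) auto
  qed
  finally show ?thesis .
qed

lemma correlation_pos_imp_return:
  assumes "(\<integral>p. indicator A p * koopman M T (int n) (indicator B) p \<partial>M) > (0::real)"
  shows "\<exists>p. p \<in> A \<and> (T ^^ n) p \<in> B"
proof (rule ccontr)
  assume "\<nexists>p. p \<in> A \<and> (T ^^ n) p \<in> B"
  then have zero: "indicator A p * indicator B ((T ^^ n) p) = (0::real)" for p by (auto simp: indicator_def)
  show False using assms unfolding koopman_nat zero by simp
qed

end

section \<open>Lower bounds for the upper densities\<close>

text \<open>Only the nonnegative half of the symmetric interval is used, which costs a factor of two; the constant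
\<open>1 / 6\<close> instead of \<open>1 / 4\<close> accounts for the summand \<open>1\<close> in \<open>2N + 1\<close> already for \<open>L k = 1\<close>.\<close>

lemma upper_density_ge:
  assumes L: "strict_mono (L :: nat \<Rightarrow> nat)" "\<And>k. L k > 0"
    and E: "\<And>k. real (card (E \<inter> {0..int (L k) - 1})) \<ge> real (L k) / 2"
  shows "upper_density E \<ge> ereal (1 / 6)"
proof -
  let ?X = "\<lambda>N. ereal (real (card (E \<inter> {- int N..int N})) / (2 * real N + 1))"
  have "ereal (1 / 6) \<le> ?X (L k)" for k
  proof -
    have "real (card (E \<inter> {0..int (L k) - 1})) \<le> real (card (E \<inter> {- int (L k)..int (L k)}))"
      by (intro of_nat_mono card_mono) auto
    then have "real (L k) / 2 \<le> real (card (E \<inter> {- int (L k)..int (L k)}))" using E[of k] by linarith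
    moreover have "(2 * real (L k) + 1) / 6 \<le> real (L k) / 2" using L(2)[of k] by simp
    ultimately have "1 / 6 \<le> real (card (E \<inter> {- int (L k)..int (L k)})) / (2 * real (L k) + 1)"
      by (simp add: field_simps)
    then show ?thesis by (simp only: ereal_less_eq(3))
  qed
  then have "ereal (1 / 6) \<le> limsup (?X \<circ> L)" by (intro le_Limsup) auto
  also have "\<dots> \<le> limsup ?X" by (rule limsup_subseq_mono[OF L(1)])
  finally show ?thesis by (simp add: upper_density_def)
qed

lemma upper_Banach_density_ge:
  assumes L: "strict_mono (L :: nat \<Rightarrow> nat)" "\<And>k. L k > 0"
    and E: "\<And>k. real (card (E \<inter> {0..int (L k) - 1})) \<ge> real (L k) / 2"
  shows "upper_Banach_density E \<ge> ereal (1 / 2)"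
  unfolding upper_Banach_density_def Limsup_def
proof (rule INF_greatest, clarify)
  fix P assume "eventually P (filtercomap (\<lambda>(M, N). N - M) (at_top :: int filter))"
  then obtain Q where Q: "eventually Q at_top" "\<And>x. Q (case x of (M, N) \<Rightarrow> N - M) \<Longrightarrow> P x"
    unfolding eventually_filtercomap by blast
  obtain c where c: "\<And>x. x \<ge> c \<Longrightarrow> Q x" using Q(1) unfolding eventually_at_top_linorder by blast
  have "int (L (nat c)) \<ge> c" using strict_mono_imp_increasing[OF L(1), of "nat c"] by linarith
  then have P: "P (0, int (L (nat c)))" using c Q(2)[of "(0, int (L (nat c)))"] by simp
  have "1 / 2 \<le> real (card (E \<inter> {0..int (L (nat c)) - 1})) / real_of_int (int (L (nat c)) - 0)"
    using E[of "nat c"] L(2)[of "nat c"] by (simp add: field_simps)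
  then have "ereal (1 / 2) \<le> (case (0, int (L (nat c))) of (M, N) \<Rightarrow>
      ereal (real (card (E \<inter> {M..N - 1})) / real_of_int (N - M)))"
    by (simp only: prod.case ereal_less_eq(3))
  also have "\<dots> \<le> (SUP x\<in>{x. P x}. case x of (M, N) \<Rightarrow> ereal (real (card (E \<inter> {M..N - 1})) / real_of_int (N - M)))"
    by (rule SUP_upper) (use P in simp)
  finally show "ereal (1 / 2) \<le> (SUP x\<in>{x. P x}. case x of (M, N) \<Rightarrow> ereal (real (card (E \<inter> {M..N - 1})) / real_of_int (N - M)))" .
qed

theorem theorem1:
  shows "\<exists>(M :: point measure) (T :: point \<Rightarrow> point) (A :: point set) (B :: point set) (Z :: point measure).
    ergodic_system M T \<and>
    A \<in> sets M \<and> B \<in> sets M \<and> measure M A > 0 \<and> measure M B > 0 \<and>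
    is_infinite_step_pronilfactor M T Z \<and>
    (let f1 = (indicator A :: point \<Rightarrow> real);
         f2 = (indicator B :: point \<Rightarrow> real);
         \<alpha> = {n :: int. (\<integral>x. f1 x * koopman M T n f2 x \<partial>M) > 0};
         \<beta> = {n :: int. (\<integral>x. real_cond_exp M Z f1 x *
                              koopman M T n (real_cond_exp M Z f2) x \<partial>M) > 0}
     in upper_density (\<beta> - \<alpha>) > 0 \<and> upper_Banach_density (\<beta> - \<alpha>) > 0)"
proof -
  obtain e where "sparse_primes e" using exists_sparse_primes by blast
  then interpret sparse_primes e .
  define \<alpha> where "\<alpha> = {n :: int. (\<integral>x. indicator A x * koopman M T n (indicator B :: point \<Rightarrow> real) x \<partial>M) > 0}"
  define \<beta> where "\<beta> = {n :: int. (\<integral>x. real_cond_exp M Z (indicator A) x *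
                              koopman M T n (real_cond_exp M Z (indicator B)) x \<partial>M) > 0}"
  define L where "L k = e (2 * k)" for k
  have L: "strict_mono L" "\<And>k. L k > 0"
    using strict_mono_e e_pos by (auto simp: L_def strict_mono_def)
  have E: "real (card ((\<beta> - \<alpha>) \<inter> {0..int (L k) - 1})) \<ge> real (L k) / 2" for k
  proof -
    let ?R = "{n. n < L k \<and> (\<exists>p. p \<in> A \<and> (T ^^ n) p \<in> B)}"
    have "int ` ({..<L k} - ?R) \<subseteq> (\<beta> - \<alpha>) \<inter> {0..int (L k) - 1}"
      using correlation_of_projections_pos[of _ k] correlation_pos_imp_return
      by (auto simp: \<alpha>_def \<beta>_def L_def)
    then have "card (int ` ({..<L k} - ?R)) \<le> card ((\<beta> - \<alpha>) \<inter> {0..int (L k) - 1})"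
      by (intro card_mono) auto
    moreover have "card (int ` ({..<L k} - ?R)) = card ({..<L k} - ?R)" by (simp add: card_image)
    moreover have "card ({..<L k} - ?R) = card {..<L k} - card ?R"
      by (rule card_Diff_subset) (auto intro: finite_subset[of _ "{..<L k}"])
    moreover have "card {..<L k} = L k" by simp
    moreover have "real (card ?R) \<le> real (L k) / 2" using card_returns_le[of k] by (simp add: L_def)
    ultimately show ?thesis by linarith
  qed
  have "0 < upper_density (\<beta> - \<alpha>)"
    by (rule less_le_trans[OF _ upper_density_ge[OF L E]]) simp
  moreover have "0 < upper_Banach_density (\<beta> - \<alpha>)"
    by (rule less_le_trans[OF _ upper_Banach_density_ge[OF L E]]) simp
  ultimately show ?thesis
    using ergodic_system_M A_measurable B_measurable measure_A_pos measure_B_pos is_infinite_step_pronilfactor_Z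
    unfolding \<alpha>_def \<beta>_def
    by (intro exI[of _ M] exI[of _ T] exI[of _ A] exI[of _ B] exI[of _ Z]) (simp add: Let_def)
qed

end
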